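(* For all $a,b\in\{1,\dots,D\}$ the subdiagonal matrix $\beta$ satisfies $$\Delta_b\Big[\frac{\partial\beta}{\partial n_a}+(\Delta_a\beta)\big(q_a+(n_a\cdot\Lambda)\beta\big)\Big](n_b\cdot\Lambda)=\Delta_a\Big[\frac{\partial\beta}{\partial n_b}+(\Delta_b\beta)\big(q_b+(n_b\cdot\Lambda)\beta\big)\Big](n_a\cdot\Lambda).$$
   Context: Let $D\ge 1$. For $k\in\mathbb Z_+$ let $[k]=\{\alpha\in\mathbb Z_+^D:|\alpha|=k\}$, ordered so that $\alpha>\alpha'$ iff at the first coordinate where they differ the entry of $\alpha$ is smaller. $\chi_{[k]}(x)$ is the column vector of monomials $x^\alpha$, $\alpha\in[k]$, and $\chi$ stacks $\chi_{[0]},\chi_{[1]},\dots$. Semi-infinite matrices are partitioned in blocks $A_{[k],[\ell]}\in\mathbb R^{|[k]|\times|[\ell]|}$. Shift matrices: $\Lambda_a$ has as only nonzero blocks $(\Lambda_a)_{[k],[k+1]}$, with entries $\delta_{\alpha+e_a,\alpha'}$, $\alpha\in[k]$, $\alpha'\in[k+1]$; $n\cdot\Lambda=\sum_an_a\Lambda_a$. Flows: fix an invertible $N=(n_{a,b})\in GL(\mathbb R^D)$ with rows $n_a$, and $q\in\mathbb R^D$ with all $q_a\ne0$. Let $\mu$ be a Borel measure with finite moments, supported in $\{x:|n_a\cdot x|<|q_a|\ \forall a\}$. For real times $t=(t_\alpha)_{\alpha\in\mathbb Z_+^D}$ and $m\in\mathbb Z^D$ put $t(x)=\sum_\alpha t_\alpha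 x^\alpha$ and let $G(t,m)=\int\chi\,d\mu_{t,m}\,\chi^\top$ be the moment matrix of $d\mu_{t,m}(x)=e^{t(x)}\prod_a(n_a\cdot x-q_a)^{m_a}d\mu(x)$. It is assumed that $G(t,m)=S^{-1}H(S^{-1})^\top$ with $S=S(t,m)$ block lower triangular with identity diagonal blocks and $H(t,m)$ block diagonal with invertible blocks. $\beta$ is the semi-infinite matrix whose only nonzero blocks are $\beta_{[k],[k-1]}=\beta_{[k]}:=S_{[k],[k-1]}$, $k\ge1$. With $t_a:=t_{e_a}$, the normal derivative is $\frac{\partial}{\partial n_a}=\sum_{b=1}^Dn_{a,b}\frac{\partial}{\partial t_b}$. $(T_af)(m)=f(m+e_a)$, $\Delta_a=T_a-1$; $\Delta_b[\cdots]$ acts on the whole bracket. A scalar $q_a$ stands for $q_a$ times the identity. *)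

theory Defs
  imports "HOL-Analysis.Analysis" "HOL-Library.Groups_Big_Fun" "HOL-Library.Function_Algebras"
begin

text \<open>
  The dimension \<open>D\<close> is \<open>CARD('d)\<close>, and \<open>axis a 1\<close> is the unit vector \<open>e_a\<close>, as a real vector,
  a multi-index or a lattice vector according to its type. Semi-infinite matrices are indexed by
  the multi-indices themselves; block \<open>([k],[l])\<close> consists of the entries whose row has degree \<open>k\<close>
  and whose column has degree \<open>l\<close>. Listing \<open>[k]\<close> in an order only fixes how the matrices are
  displayed, so no order is chosen. Addition and subtraction of matrices are pointwise; the
  pointwise product and unit of \<open>Function_Algebras\<close> are not used.
\<close>

type_synonym 'd mindex = "nat ^ 'd"
type_synonym 'd smat = "nat ^ 'd \<Rightarrow> nat ^ 'd \<Rightarrow> real"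
type_synonym 'd times = "nat ^ 'd \<Rightarrow> real"

definition mdeg :: "'d::finite mindex \<Rightarrow> nat" where
  "mdeg \<alpha> = (\<Sum>i\<in>UNIV. \<alpha> $ i)"

definition level :: "nat \<Rightarrow> ('d::finite mindex) set" where
  "level k = {\<alpha>. mdeg \<alpha> = k}"

definition chi :: "real ^ 'd::finite \<Rightarrow> 'd mindex \<Rightarrow> real" where
  "chi x \<alpha> = (\<Prod>i\<in>UNIV. (x $ i) ^ (\<alpha> $ i))"


subsection \<open>Semi-infinite matrices\<close>

text \<open>
  The sum runs over the finitely many indices with nonzero contribution. In all products below
  there are only finitely many of them, since one factor is block lower triangular on the left,
  block upper triangular on the right, or block banded.
\<close>

definition smult :: "'d::finite smat \<Rightarrow> 'd smat \<Rightarrow> 'd smat" (infixl "\<odot>" 70) where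
  "A \<odot> B = (\<lambda>\<alpha> \<alpha>'. Sum_any (\<lambda>\<gamma>. A \<alpha> \<gamma> * B \<gamma> \<alpha>'))"

definition scalar :: "real \<Rightarrow> 'd::finite smat" where
  "scalar c = (\<lambda>\<alpha> \<alpha>'. if \<alpha> = \<alpha>' then c else 0)"

definition stranspose :: "'d::finite smat \<Rightarrow> 'd smat" where
  "stranspose A = (\<lambda>\<alpha> \<alpha>'. A \<alpha>' \<alpha>)"

definition block_lower_unitriangular :: "'d::finite smat \<Rightarrow> bool" where
  "block_lower_unitriangular S \<longleftrightarrow>
     (\<forall>\<alpha> \<alpha>'. mdeg \<alpha> < mdeg \<alpha>' \<longrightarrow> S \<alpha> \<alpha>' = 0) \<and>
     (\<forall>k. \<forall>\<alpha>\<in>level k. \<forall>\<alpha>'\<in>level k. S \<alpha> \<alpha>' = (if \<alpha> = \<alpha>' then 1 else 0))"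

definition block_diagonal :: "'d::finite smat \<Rightarrow> bool" where
  "block_diagonal H \<longleftrightarrow> (\<forall>\<alpha> \<alpha>'. mdeg \<alpha> \<noteq> mdeg \<alpha>' \<longrightarrow> H \<alpha> \<alpha>' = 0)"

definition invertible_block :: "nat \<Rightarrow> 'd::finite smat \<Rightarrow> bool" where
  "invertible_block k H \<longleftrightarrow>
     (\<exists>K. \<forall>\<alpha>\<in>level k. \<forall>\<alpha>'\<in>level k.
        (\<Sum>\<gamma>\<in>level k. H \<alpha> \<gamma> * K \<gamma> \<alpha>') = (if \<alpha> = \<alpha>' then 1 else 0) \<and>
        (\<Sum>\<gamma>\<in>level k. K \<alpha> \<gamma> * H \<gamma> \<alpha>') = (if \<alpha> = \<alpha>' then 1 else 0))"

text \<open>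
  A block lower unitriangular \<open>S\<close> has exactly one two-sided inverse, so \<open>R\<close> below
  is \<open>S\<close>\<open>^-1\<close>.
\<close>

definition block_cholesky :: "'d::finite smat \<Rightarrow> 'd smat \<Rightarrow> 'd smat \<Rightarrow> bool" where
  "block_cholesky G S H \<longleftrightarrow>
     block_lower_unitriangular S \<and> block_diagonal H \<and> (\<forall>k. invertible_block k H) \<and>
     (\<exists>R. S \<odot> R = scalar 1 \<and> R \<odot> S = scalar 1 \<and> G = R \<odot> H \<odot> stranspose R)"

definition subdiagonal :: "'d::finite smat \<Rightarrow> 'd smat" where
  "subdiagonal S = (\<lambda>\<alpha> \<alpha>'. if mdeg \<alpha> = mdeg \<alpha>' + 1 then S \<alpha> \<alpha>' else 0)"

definition Lam :: "'d::finite \<Rightarrow> 'd smat" where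
  "Lam a = (\<lambda>\<alpha> \<alpha>'. if \<alpha> + axis a 1 = \<alpha>' then 1 else 0)"

definition dotLam :: "real ^ 'd::finite \<Rightarrow> 'd smat" where
  "dotLam n = (\<lambda>\<alpha> \<alpha>'. \<Sum>a\<in>UNIV. n $ a * Lam a \<alpha> \<alpha>')"


subsection \<open>The deformed moment matrix\<close>

definition tfun :: "'d::finite times \<Rightarrow> real ^ 'd \<Rightarrow> real" where
  "tfun t x = (\<Sum>\<^sub>\<infinity>\<alpha>. t \<alpha> * chi x \<alpha>)"

definition weight ::
  "real ^ 'd ^ 'd \<Rightarrow> real ^ 'd \<Rightarrow> 'd::finite times \<Rightarrow> int ^ 'd \<Rightarrow> real ^ 'd \<Rightarrow> real" where
  "weight N q t m x = exp (tfun t x) * (\<Prod>a\<in>UNIV. (N $ a \<bullet> x - q $ a) powi (m $ a))"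

text \<open>The weight may be negative, so it is put in the integrand instead of using \<open>density\<close>.\<close>

definition moment_matrix ::
  "(real ^ 'd) measure \<Rightarrow> real ^ 'd ^ 'd \<Rightarrow> real ^ 'd \<Rightarrow> 'd::finite times \<Rightarrow> int ^ 'd \<Rightarrow> 'd smat" where
  "moment_matrix M N q t m = (\<lambda>\<alpha> \<alpha>'. LINT x|M. chi x \<alpha> * weight N q t m x * chi x \<alpha>')"

text \<open>
  The times for which the deformed measures make sense: the series \<open>t(x)\<close> converges and all
  deformed moments exist. If the topological support of \<open>M\<close> lies in the open parallelepiped
  \<open>|n_a \<bullet> x| < |q_a|\<close>, it is compact there, and every \<open>t\<close> whose series converges with bounded
  sum on the support is included, in particular every finitely supported \<open>t\<close>.
\<close>

definition admissible_times ::
  "(real ^ 'd) measure \<Rightarrow> real ^ 'd ^ 'd \<Rightarrow> real ^ 'd \<Rightarrow> ('d::finite times) set" where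
  "admissible_times M N q = {t.
     (AE x in M. (\<lambda>\<alpha>. t \<alpha> * chi x \<alpha>) summable_on UNIV) \<and>
     (\<forall>m \<alpha>. integrable M (\<lambda>x. chi x \<alpha> * weight N q t m x))}"


subsection \<open>Difference and differential operators\<close>

definition lattice_diff ::
  "'d::finite \<Rightarrow> ('d times \<Rightarrow> int ^ 'd \<Rightarrow> 'd smat) \<Rightarrow> 'd times \<Rightarrow> int ^ 'd \<Rightarrow> 'd smat" where
  "lattice_diff a F t m = F t (m + axis a 1) - F t m"

definition normal_deriv ::
  "real ^ 'd \<Rightarrow> ('d times \<Rightarrow> int ^ 'd \<Rightarrow> 'd smat) \<Rightarrow> 'd::finite times \<Rightarrow> int ^ 'd \<Rightarrow> 'd smat" where
  "normal_deriv n F t m = (\<lambda>\<alpha> \<alpha>'.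
     \<Sum>b\<in>UNIV. n $ b * deriv (\<lambda>s. F (t(axis b 1 := s)) m \<alpha> \<alpha>') (t (axis b 1)))"

end

theory Submission
  imports Defs
begin

text \<open>
  Write \<open>L\<^sub>a\<close> for \<open>n\<^sub>a \<cdot> \<Lambda>\<close>. The rows of \<open>P = S \<chi>\<close> are monic orthogonal polynomials, and \<open>T\<^sub>a\<close> multiplies
  the measure by \<open>n\<^sub>a \<cdot> x - q\<^sub>a\<close>. Hence \<open>P\<close> at level \<open>k\<close> is still orthogonal, for the new measure, to
  all degrees below \<open>k - 1\<close>, so \<open>P = T\<^sub>a P - (\<Delta>\<^sub>a \<beta>) T\<^sub>a P\<close>. Its second subdiagonal reads
  \<open>\<Delta>\<^sub>a S\<^sub>2 = (\<Delta>\<^sub>a \<beta>) (T\<^sub>a \<beta>)\<close>, where \<open>S\<^sub>2\<close> is the second subdiagonal of \<open>S\<close>. Differentiating the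
  orthogonality relations in \<open>t\<close> gives
  \<open>\<partial>\<beta>/\<partial>n\<^sub>a = (\<Delta>\<^sub>a \<beta>) ((T\<^sub>a \<beta>) L\<^sub>a - L\<^sub>a \<beta> - q\<^sub>a)\<close>. The bracket in the theorem is therefore
  \<open>(\<Delta>\<^sub>a S\<^sub>2) L\<^sub>a\<close>, and both sides equal \<open>(\<Delta>\<^sub>a \<Delta>\<^sub>b S\<^sub>2) L\<^sub>a L\<^sub>b\<close>.
\<close>

subsection \<open>Truncated block Cholesky factorizations\<close>

definition below :: "nat \<Rightarrow> ('d::finite mindex) set" where
  "below n = {\<gamma>. mdeg \<gamma> < n}"

lemma in_below [simp]: "\<gamma> \<in> below n \<longleftrightarrow> mdeg \<gamma> < n"
  by (simp add: below_def)

lemma in_level [simp]: "\<gamma> \<in> level n \<longleftrightarrow> mdeg \<gamma> = n"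
  by (simp add: level_def)

lemma finite_below [simp]: "finite (below n :: ('d::finite mindex) set)"
proof -
  have "finite (PiE (UNIV :: 'd set) (\<lambda>_. {..<n}))"
    by (intro finite_PiE) auto
  then have "finite (vec_lambda ` PiE (UNIV :: 'd set) (\<lambda>_. {..<n}))"
    by simp
  moreover have "below n \<subseteq> vec_lambda ` PiE (UNIV :: 'd set) (\<lambda>_. {..<n})"
  proof
    fix v :: "'d mindex" assume "v \<in> below n"
    then have "(\<Sum>i\<in>UNIV. v $ i) < n" by (simp add: mdeg_def)
    moreover have "v $ i \<le> (\<Sum>i\<in>UNIV. v $ i)" for i
      by (rule member_le_sum) auto
    ultimately have "v $ i < n" for i using le_less_trans by blast
    then have "vec_nth v \<in> PiE UNIV (\<lambda>_. {..<n})" by auto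
    then show "v \<in> vec_lambda ` PiE (UNIV :: 'd set) (\<lambda>_. {..<n})"
      by (metis image_eqI vec_nth_inverse)
  qed
  ultimately show ?thesis by (rule rev_finite_subset)
qed

lemma finite_level [simp]: "finite (level n :: ('d::finite mindex) set)"
  by (rule finite_subset[OF _ finite_below[of "Suc n"]]) auto

lemma mdeg_axis [simp]: "mdeg (\<gamma> + axis a 1) = Suc (mdeg \<gamma>)"
  by (simp add: mdeg_def axis_def sum.distrib)

text \<open>The same fact for the unit vector in the form \<open>axis a (Suc 0)\<close>, to which
  \<open>axis a 1\<close> is simplified over the naturals.\<close>

lemmas mdeg_axis_Suc [simp] = mdeg_axis[simplified]

lemma smult_eq_sum:
  assumes "finite I" and "\<And>\<gamma>. \<gamma> \<notin> I \<Longrightarrow> A \<alpha> \<gamma> * B \<gamma> \<alpha>' = 0"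
  shows "(A \<odot> B) \<alpha> \<alpha>' = (\<Sum>\<gamma>\<in>I. A \<alpha> \<gamma> * B \<gamma> \<alpha>')"
  unfolding smult_def using assms by (intro Sum_any.expand_superset) auto

lemma sum_delta_below:
  fixes f :: "_ \<Rightarrow> real"
  assumes "mdeg \<alpha> < n"
  shows "(\<Sum>\<gamma>\<in>below n. (if \<alpha> = \<gamma> then 1 else 0) * f \<gamma>) = f \<alpha>"
proof -
  have "(\<Sum>\<gamma>\<in>below n. (if \<alpha> = \<gamma> then 1 else 0) * f \<gamma>) = (\<Sum>\<gamma>\<in>below n. if \<alpha> = \<gamma> then f \<gamma> else 0)"
    by (intro sum.cong) auto
  then show ?thesis using assms by simp
qed

lemma sum_below_Suc:
  assumes "\<And>\<epsilon>. mdeg \<epsilon> = k \<Longrightarrow> f \<epsilon> = (0::real)"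
  shows "sum f (below (Suc k)) = sum f (below k)"
  using assms by (intro sum.mono_neutral_right) (auto simp: less_Suc_eq)

lemma sum_mult_assoc:
  fixes p :: "_ \<Rightarrow> 'a::comm_semiring_0"
  shows "(\<Sum>j\<in>J. (\<Sum>i\<in>I. p i * A i j) * B j) = (\<Sum>i\<in>I. p i * (\<Sum>j\<in>J. A i j * B j))"
  unfolding sum_distrib_left sum_distrib_right
  by (subst sum.swap) (simp add: mult.assoc)

section \<open>Triangular factors, orthogonality and nondegeneracy\<close>

lemma block_lower_unitriangularD:
  assumes "block_lower_unitriangular S" and "mdeg \<gamma> \<le> mdeg \<epsilon>"
  shows "S \<gamma> \<epsilon> = (if \<gamma> = \<epsilon> then 1 else 0)"
proof (cases "mdeg \<gamma> = mdeg \<epsilon>")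
  case True
  then have "\<gamma> \<in> level (mdeg \<gamma>)" "\<epsilon> \<in> level (mdeg \<gamma>)" by auto
  then show ?thesis using assms(1) unfolding block_lower_unitriangular_def by blast
next
  case False
  then show ?thesis using assms by (auto simp: block_lower_unitriangular_def)
qed

lemma block_cholesky_lower:
  assumes "block_cholesky G S H" and "mdeg \<gamma> \<le> mdeg \<epsilon>"
  shows "S \<gamma> \<epsilon> = (if \<gamma> = \<epsilon> then 1 else 0)"
  using assms block_lower_unitriangularD unfolding block_cholesky_def by blast

text \<open>Induction on the degree of the row: row \<alpha> of \<open>S \<odot> R\<close> is row
  \<alpha> of \<open>R\<close> plus a combination of rows of smaller degree, and these already
  vanish in column \<alpha>'.\<close>

lemma block_lower_inverse:
  fixes S :: "'d::finite smat"
  assumes S: "block_lower_unitriangular S" and R: "S \<odot> R = scalar 1"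
  shows "mdeg \<alpha> < mdeg \<alpha>' \<Longrightarrow> R \<alpha> \<alpha>' = 0"
proof (induction "mdeg \<alpha>" arbitrary: \<alpha> rule: less_induct)
  case less
  have "(S \<odot> R) \<alpha> \<alpha>' = (\<Sum>\<gamma>\<in>below (Suc (mdeg \<alpha>)). S \<alpha> \<gamma> * R \<gamma> \<alpha>')"
    using S by (intro smult_eq_sum) (auto simp: block_lower_unitriangular_def)
  also have "\<dots> = (\<Sum>\<gamma>\<in>below (Suc (mdeg \<alpha>)). (if \<alpha> = \<gamma> then 1 else 0) * R \<gamma> \<alpha>')"
  proof (intro sum.cong refl)
    fix \<gamma> :: "'d mindex" assume "\<gamma> \<in> below (Suc (mdeg \<alpha>))"
    then consider "mdeg \<gamma> < mdeg \<alpha>" | "mdeg \<gamma> = mdeg \<alpha>" by fastforce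
    then show "S \<alpha> \<gamma> * R \<gamma> \<alpha>' = (if \<alpha> = \<gamma> then 1 else 0) * R \<gamma> \<alpha>'"
    proof cases
      case 1 then show ?thesis using less by simp
    next
      case 2 then show ?thesis using block_lower_unitriangularD[OF S, of \<alpha> \<gamma>] by simp
    qed
  qed
  also have "\<dots> = R \<alpha> \<alpha>'" by (rule sum_delta_below) simp
  finally show ?case using less.prems by (auto simp: R scalar_def split: if_splits)
qed

text \<open>Since \<open>S\<close> and \<open>R\<close> are block lower triangular, every product in
  the factorization, read in rows of degree below \<open>n\<close>, only meets indices of degree
  below \<open>n\<close>. The semi-infinite identities thus become identities of finite matrices,
  for all \<open>n\<close> with the same \<open>R\<close>.\<close>

lemma block_cholesky_truncated:
  fixes S :: "'d::finite smat"
  assumes "block_cholesky G S H"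
  obtains R :: "'d smat" where
    "\<And>\<alpha> \<alpha>'. mdeg \<alpha> < mdeg \<alpha>' \<Longrightarrow> R \<alpha> \<alpha>' = 0"
    "\<And>n \<alpha> \<alpha>'. mdeg \<alpha> < n \<Longrightarrow> (\<Sum>\<gamma>\<in>below n. S \<alpha> \<gamma> * R \<gamma> \<alpha>') = (if \<alpha> = \<alpha>' then 1 else 0)"
    "\<And>n \<alpha> \<alpha>'. mdeg \<alpha> < n \<Longrightarrow> (\<Sum>\<gamma>\<in>below n. R \<alpha> \<gamma> * S \<gamma> \<alpha>') = (if \<alpha> = \<alpha>' then 1 else 0)"
    "\<And>n \<alpha> \<alpha>'. mdeg \<alpha> < n \<Longrightarrow> mdeg \<alpha>' < n \<Longrightarrow>
       G \<alpha> \<alpha>' = (\<Sum>\<gamma>\<in>below n. R \<alpha> \<gamma> * (\<Sum>\<epsilon>\<in>below n. H \<gamma> \<epsilon> * R \<alpha>' \<epsilon>))"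
proof -
  from assms obtain R where S: "block_lower_unitriangular S" and SR: "S \<odot> R = scalar 1"
    and RS: "R \<odot> S = scalar 1" and G: "G = R \<odot> H \<odot> stranspose R" and H: "block_diagonal H"
    unfolding block_cholesky_def by blast
  note R = block_lower_inverse[OF S SR]
  have 1: "(\<Sum>\<gamma>\<in>below n. S \<alpha> \<gamma> * R \<gamma> \<alpha>') = (if \<alpha> = \<alpha>' then 1 else 0)" if "mdeg \<alpha> < n" for n \<alpha> \<alpha>'
  proof -
    have "(S \<odot> R) \<alpha> \<alpha>' = (\<Sum>\<gamma>\<in>below n. S \<alpha> \<gamma> * R \<gamma> \<alpha>')"
      using S that by (intro smult_eq_sum) (auto simp: block_lower_unitriangular_def)
    then show ?thesis by (simp add: SR scalar_def)
  qed
  have 2: "(\<Sum>\<gamma>\<in>below n. R \<alpha> \<gamma> * S \<gamma> \<alpha>') = (if \<alpha> = \<alpha>' then 1 else 0)" if "mdeg \<alpha> < n" for n \<alpha> \<alpha>'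
  proof -
    have "(R \<odot> S) \<alpha> \<alpha>' = (\<Sum>\<gamma>\<in>below n. R \<alpha> \<gamma> * S \<gamma> \<alpha>')"
      using R that by (intro smult_eq_sum) auto
    then show ?thesis by (simp add: RS scalar_def)
  qed
  have 3: "G \<alpha> \<alpha>' = (\<Sum>\<gamma>\<in>below n. R \<alpha> \<gamma> * (\<Sum>\<epsilon>\<in>below n. H \<gamma> \<epsilon> * R \<alpha>' \<epsilon>))"
    if "mdeg \<alpha> < n" "mdeg \<alpha>' < n" for n \<alpha> \<alpha>'
  proof -
    have RH: "(R \<odot> H) \<alpha> \<epsilon> = (\<Sum>\<gamma>\<in>below n. R \<alpha> \<gamma> * H \<gamma> \<epsilon>)" for \<epsilon>
      using R that by (intro smult_eq_sum) auto
    have "G \<alpha> \<alpha>' = (\<Sum>\<epsilon>\<in>below n. (R \<odot> H) \<alpha> \<epsilon> * stranspose R \<epsilon> \<alpha>')"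
      unfolding G using R that by (intro smult_eq_sum) (auto simp: stranspose_def)
    then show ?thesis by (simp add: RH sum_mult_assoc stranspose_def)
  qed
  show thesis using that[OF R 1 2 3] by blast
qed

text \<open>\<open>S G = H R^T\<close> is block upper triangular, so its entries below the block
  diagonal vanish. For a moment matrix this says that row \<alpha> of \<open>S\<close> holds the
  coefficients of a polynomial orthogonal to all monomials of smaller degree.\<close>

lemma block_cholesky_orthogonal:
  fixes S :: "'d::finite smat"
  assumes "block_cholesky G S H" and "mdeg \<delta> < mdeg \<alpha>" and "mdeg \<alpha> < n"
  shows "(\<Sum>\<gamma>\<in>below n. S \<alpha> \<gamma> * G \<gamma> \<delta>) = 0"
proof -
  obtain R :: "'d smat" where
    R: "\<And>\<alpha> \<alpha>'. mdeg \<alpha> < mdeg \<alpha>' \<Longrightarrow> R \<alpha> \<alpha>' = 0" and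
    SR: "\<And>n \<alpha> \<alpha>'. mdeg \<alpha> < n \<Longrightarrow> (\<Sum>\<gamma>\<in>below n. S \<alpha> \<gamma> * R \<gamma> \<alpha>') = (if \<alpha> = \<alpha>' then 1 else 0)" and
    RS: "\<And>n \<alpha> \<alpha>'. mdeg \<alpha> < n \<Longrightarrow> (\<Sum>\<gamma>\<in>below n. R \<alpha> \<gamma> * S \<gamma> \<alpha>') = (if \<alpha> = \<alpha>' then 1 else 0)" and
    G: "\<And>n \<alpha> \<alpha>'. mdeg \<alpha> < n \<Longrightarrow> mdeg \<alpha>' < n \<Longrightarrow>
       G \<alpha> \<alpha>' = (\<Sum>\<gamma>\<in>below n. R \<alpha> \<gamma> * (\<Sum>\<epsilon>\<in>below n. H \<gamma> \<epsilon> * R \<alpha>' \<epsilon>))"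
    by (fact block_cholesky_truncated[OF assms(1)])
  have H: "H \<gamma> \<epsilon> = 0" if "mdeg \<gamma> \<noteq> mdeg \<epsilon>" for \<gamma> \<epsilon>
    using assms(1) that by (auto simp: block_cholesky_def block_diagonal_def)
  have "(\<Sum>\<gamma>\<in>below n. S \<alpha> \<gamma> * G \<gamma> \<delta>)
      = (\<Sum>\<gamma>\<in>below n. S \<alpha> \<gamma> * (\<Sum>\<eta>\<in>below n. R \<gamma> \<eta> * (\<Sum>\<epsilon>\<in>below n. H \<eta> \<epsilon> * R \<delta> \<epsilon>)))"
    using assms by (intro sum.cong) (auto intro: G)
  also have "\<dots> = (\<Sum>\<eta>\<in>below n. (if \<alpha> = \<eta> then 1 else 0) * (\<Sum>\<epsilon>\<in>below n. H \<eta> \<epsilon> * R \<delta> \<epsilon>))"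
    unfolding sum_mult_assoc[symmetric] using assms by (simp add: SR)
  also have "\<dots> = (\<Sum>\<epsilon>\<in>below n. H \<alpha> \<epsilon> * R \<delta> \<epsilon>)"
    using assms by (intro sum_delta_below)
  \<comment> \<open>A nonzero \<open>H \<alpha> \<epsilon>\<close> forces \<epsilon> to have the
    degree of \<alpha>, which exceeds that of \<delta>, and then
    \<open>R \<delta> \<epsilon>\<close> vanishes.\<close>
  also have "\<dots> = 0"
    using assms by (intro sum.neutral) (metis H R mult_eq_0_iff)
  finally show ?thesis .
qed

text \<open>The inverses of the single blocks are assembled into one block diagonal matrix, which
  inverts every truncation of \<open>H\<close> at once.\<close>

lemma block_diagonal_right_inverse:
  fixes H :: "'d::finite smat"
  assumes "block_diagonal H" and "\<And>k. invertible_block k H"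
  obtains K :: "'d smat" where "\<And>n \<alpha> \<alpha>'. mdeg \<alpha> < n \<Longrightarrow> (\<Sum>\<gamma>\<in>below n. H \<alpha> \<gamma> * K \<gamma> \<alpha>') = (if \<alpha> = \<alpha>' then 1 else 0)"
proof -
  have "\<forall>k. \<exists>L. \<forall>\<alpha>\<in>level k. \<forall>\<alpha>'\<in>level k.
      (\<Sum>\<gamma>\<in>level k. H \<alpha> \<gamma> * L \<gamma> \<alpha>') = (if \<alpha> = \<alpha>' then 1 else 0)"
    using assms(2) unfolding invertible_block_def by blast
  then obtain L :: "nat \<Rightarrow> 'd smat" where L: "\<And>k \<alpha> \<alpha>'. mdeg \<alpha> = k \<Longrightarrow> mdeg \<alpha>' = k \<Longrightarrow>
      (\<Sum>\<gamma>\<in>level k. H \<alpha> \<gamma> * L k \<gamma> \<alpha>') = (if \<alpha> = \<alpha>' then 1 else 0)"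
    using in_level by (elim exE[OF choice]) blast
  define K :: "'d smat" where "K \<gamma> \<alpha>' = (if mdeg \<gamma> = mdeg \<alpha>' then L (mdeg \<gamma>) \<gamma> \<alpha>' else 0)" for \<gamma> \<alpha>'
  have "(\<Sum>\<gamma>\<in>below n. H \<alpha> \<gamma> * K \<gamma> \<alpha>') = (if \<alpha> = \<alpha>' then 1 else 0)" if "mdeg \<alpha> < n" for n \<alpha> \<alpha>'
  proof -
    have "(\<Sum>\<gamma>\<in>below n. H \<alpha> \<gamma> * K \<gamma> \<alpha>') = (\<Sum>\<gamma>\<in>level (mdeg \<alpha>). H \<alpha> \<gamma> * K \<gamma> \<alpha>')"
      using that assms(1) by (intro sum.mono_neutral_right) (auto simp: block_diagonal_def)
    also have "\<dots> = (if \<alpha> = \<alpha>' then 1 else 0)"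
    proof (cases "mdeg \<alpha> = mdeg \<alpha>'")
      case True
      then have "(\<Sum>\<gamma>\<in>level (mdeg \<alpha>). H \<alpha> \<gamma> * K \<gamma> \<alpha>') = (\<Sum>\<gamma>\<in>level (mdeg \<alpha>). H \<alpha> \<gamma> * L (mdeg \<alpha>) \<gamma> \<alpha>')"
        by (intro sum.cong) (auto simp: K_def)
      then show ?thesis using L True by simp
    next
      case False
      then show ?thesis by (auto simp: K_def intro!: sum.neutral)
    qed
    finally show ?thesis .
  qed
  then show thesis using that by blast
qed

text \<open>The truncation of \<open>G\<close> is \<open>R H R^T\<close> with finite factors, so
  \<open>S^T L S\<close> inverts it from the right, where \<open>L\<close> is a right inverse of
  \<open>H\<close>.\<close>

lemma block_cholesky_right_inverse:
  fixes S :: "'d::finite smat"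
  assumes "block_cholesky G S H"
  obtains K :: "'d smat" where "\<And>\<alpha> \<alpha>'. mdeg \<alpha> < n \<Longrightarrow> mdeg \<alpha>' < n \<Longrightarrow>
    (\<Sum>\<gamma>\<in>below n. G \<alpha> \<gamma> * K \<gamma> \<alpha>') = (if \<alpha> = \<alpha>' then 1 else 0)"
proof -
  obtain R :: "'d smat" where
    R: "\<And>\<alpha> \<alpha>'. mdeg \<alpha> < mdeg \<alpha>' \<Longrightarrow> R \<alpha> \<alpha>' = 0" and
    SR: "\<And>n \<alpha> \<alpha>'. mdeg \<alpha> < n \<Longrightarrow> (\<Sum>\<gamma>\<in>below n. S \<alpha> \<gamma> * R \<gamma> \<alpha>') = (if \<alpha> = \<alpha>' then 1 else 0)" and
    RS: "\<And>n \<alpha> \<alpha>'. mdeg \<alpha> < n \<Longrightarrow> (\<Sum>\<gamma>\<in>below n. R \<alpha> \<gamma> * S \<gamma> \<alpha>') = (if \<alpha> = \<alpha>' then 1 else 0)" and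
    G: "\<And>n \<alpha> \<alpha>'. mdeg \<alpha> < n \<Longrightarrow> mdeg \<alpha>' < n \<Longrightarrow>
       G \<alpha> \<alpha>' = (\<Sum>\<gamma>\<in>below n. R \<alpha> \<gamma> * (\<Sum>\<epsilon>\<in>below n. H \<gamma> \<epsilon> * R \<alpha>' \<epsilon>))"
    by (fact block_cholesky_truncated[OF assms(1)])
  obtain L :: "'d smat" where L: "\<And>n \<alpha> \<alpha>'. mdeg \<alpha> < n \<Longrightarrow> (\<Sum>\<gamma>\<in>below n. H \<alpha> \<gamma> * L \<gamma> \<alpha>') = (if \<alpha> = \<alpha>' then 1 else 0)"
    using block_diagonal_right_inverse[of H thesis] assms that unfolding block_cholesky_def by blast
  define K :: "'d smat" where "K \<gamma> \<alpha>' = (\<Sum>\<mu>\<in>below n. S \<mu> \<gamma> * (\<Sum>\<nu>\<in>below n. L \<mu> \<nu> * S \<nu> \<alpha>'))" for \<gamma> \<alpha>'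
  have RK: "(\<Sum>\<gamma>\<in>below n. R \<gamma> \<epsilon> * K \<gamma> \<alpha>') = (\<Sum>\<nu>\<in>below n. L \<epsilon> \<nu> * S \<nu> \<alpha>')" if "mdeg \<epsilon> < n" for \<epsilon> \<alpha>'
  proof -
    have "(\<Sum>\<gamma>\<in>below n. R \<gamma> \<epsilon> * K \<gamma> \<alpha>')
        = (\<Sum>\<mu>\<in>below n. (\<Sum>\<gamma>\<in>below n. S \<mu> \<gamma> * R \<gamma> \<epsilon>) * (\<Sum>\<nu>\<in>below n. L \<mu> \<nu> * S \<nu> \<alpha>'))"
      unfolding K_def by (subst sum_mult_assoc[symmetric]) (simp add: mult.commute)
    also have "\<dots> = (\<Sum>\<mu>\<in>below n. (if \<epsilon> = \<mu> then 1 else 0) * (\<Sum>\<nu>\<in>below n. L \<mu> \<nu> * S \<nu> \<alpha>'))"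
      by (intro sum.cong) (auto simp: SR)
    also have "\<dots> = (\<Sum>\<nu>\<in>below n. L \<epsilon> \<nu> * S \<nu> \<alpha>')"
      using that by (rule sum_delta_below)
    finally show ?thesis .
  qed
  have HL: "(\<Sum>\<epsilon>\<in>below n. H \<mu> \<epsilon> * (\<Sum>\<nu>\<in>below n. L \<epsilon> \<nu> * S \<nu> \<alpha>')) = S \<mu> \<alpha>'" if "mdeg \<mu> < n" for \<mu> \<alpha>'
    unfolding sum_mult_assoc[symmetric] using that by (simp add: L sum_delta_below)
  have "(\<Sum>\<gamma>\<in>below n. G \<alpha> \<gamma> * K \<gamma> \<alpha>') = (if \<alpha> = \<alpha>' then 1 else 0)" if "mdeg \<alpha> < n" for \<alpha> \<alpha>'
  proof -
    have "(\<Sum>\<gamma>\<in>below n. G \<alpha> \<gamma> * K \<gamma> \<alpha>')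
        = (\<Sum>\<gamma>\<in>below n. (\<Sum>\<mu>\<in>below n. R \<alpha> \<mu> * (\<Sum>\<epsilon>\<in>below n. H \<mu> \<epsilon> * R \<gamma> \<epsilon>)) * K \<gamma> \<alpha>')"
      using that by (intro sum.cong refl) (auto simp: G)
    also have "\<dots> = (\<Sum>\<mu>\<in>below n. R \<alpha> \<mu> * (\<Sum>\<epsilon>\<in>below n. H \<mu> \<epsilon> * (\<Sum>\<gamma>\<in>below n. R \<gamma> \<epsilon> * K \<gamma> \<alpha>')))"
      by (simp add: sum_mult_assoc)
    also have "\<dots> = (\<Sum>\<mu>\<in>below n. R \<alpha> \<mu> * S \<mu> \<alpha>')"
      by (intro sum.cong) (auto simp: RK HL)
    finally show ?thesis using that by (simp add: RS)
  qed
  then show thesis using that by blast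
qed

text \<open>The relation \<open>p G = 0\<close> on the truncation is multiplied from the right by
  the inverse of the truncated \<open>G\<close>. It serves as the uniqueness principle: polynomials
  of degree below \<open>n\<close> are determined by their pairings with the monomials of degree
  below \<open>n\<close>.\<close>

lemma block_cholesky_nondegenerate:
  fixes S :: "'d::finite smat"
  assumes "block_cholesky G S H" and "\<And>\<delta>. mdeg \<delta> < n \<Longrightarrow> (\<Sum>\<gamma>\<in>below n. p \<gamma> * G \<gamma> \<delta>) = 0"
    and "mdeg \<alpha> < n"
  shows "p \<alpha> = 0"
proof -
  obtain K :: "'d smat" where K: "\<And>\<alpha> \<alpha>'. mdeg \<alpha> < n \<Longrightarrow> mdeg \<alpha>' < n \<Longrightarrow>
    (\<Sum>\<gamma>\<in>below n. G \<alpha> \<gamma> * K \<gamma> \<alpha>') = (if \<alpha> = \<alpha>' then 1 else 0)"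
    by (fact block_cholesky_right_inverse[OF assms(1)])
  have "0 = (\<Sum>\<delta>\<in>below n. (\<Sum>\<gamma>\<in>below n. p \<gamma> * G \<gamma> \<delta>) * K \<delta> \<alpha>)"
    using assms(2) by simp
  also have "\<dots> = (\<Sum>\<gamma>\<in>below n. p \<gamma> * (if \<gamma> = \<alpha> then 1 else 0))"
    unfolding sum_mult_assoc using K assms(3) by simp
  also have "\<dots> = (\<Sum>\<gamma>\<in>below n. (if \<alpha> = \<gamma> then 1 else 0) * p \<gamma>)"
    by (intro sum.cong) auto
  also have "\<dots> = p \<alpha>" using assms(3) by (rule sum_delta_below)
  finally show ?thesis by simp
qed

text \<open>Read \<open>p\<close> as a polynomial of degree at most \<open>k\<close> that is
  orthogonal to all degrees below \<open>k\<close>. Subtracting the combination of the monic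
  orthogonal polynomials of degree \<open>k\<close> with the same leading coefficients leaves a
  remainder \<open>r\<close> of degree below \<open>k\<close> with the same orthogonality, so
  \<open>r\<close> is zero by nondegeneracy.\<close>

lemma block_cholesky_expansion:
  assumes "block_cholesky G S H"
    and "\<And>\<gamma>. k < mdeg \<gamma> \<Longrightarrow> p \<gamma> = 0"
    and "\<And>\<delta>. mdeg \<delta> < k \<Longrightarrow> (\<Sum>\<gamma>\<in>below (Suc k). p \<gamma> * G \<gamma> \<delta>) = 0"
  shows "p \<epsilon> = (\<Sum>\<gamma>\<in>level k. p \<gamma> * S \<gamma> \<epsilon>)"
proof -
  have S: "S \<gamma> \<epsilon> = (if \<gamma> = \<epsilon> then 1 else 0)" if "mdeg \<gamma> \<le> mdeg \<epsilon>" for \<gamma> \<epsilon>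
    using block_cholesky_lower[OF assms(1) that] .
  define r where "r \<epsilon> = p \<epsilon> - (\<Sum>\<gamma>\<in>level k. p \<gamma> * S \<gamma> \<epsilon>)" for \<epsilon>
  have high: "r \<epsilon> = 0" if "k \<le> mdeg \<epsilon>" for \<epsilon>
  proof -
    have "(\<Sum>\<gamma>\<in>level k. p \<gamma> * S \<gamma> \<epsilon>) = (\<Sum>\<gamma>\<in>level k. if \<gamma> = \<epsilon> then p \<gamma> else 0)"
      using that by (intro sum.cong) (auto simp: S)
    then show ?thesis using assms(2)[of \<epsilon>] that by (auto simp: r_def)
  qed
  have "(\<Sum>\<epsilon>\<in>below k. r \<epsilon> * G \<epsilon> \<delta>) = 0" if "mdeg \<delta> < k" for \<delta>
  proof -
    have "(\<Sum>\<epsilon>\<in>below k. r \<epsilon> * G \<epsilon> \<delta>) = (\<Sum>\<epsilon>\<in>below (Suc k). r \<epsilon> * G \<epsilon> \<delta>)"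
      by (intro sum.mono_neutral_left) (auto simp: high)
    also have "\<dots> = (\<Sum>\<epsilon>\<in>below (Suc k). p \<epsilon> * G \<epsilon> \<delta>)
        - (\<Sum>\<gamma>\<in>level k. p \<gamma> * (\<Sum>\<epsilon>\<in>below (Suc k). S \<gamma> \<epsilon> * G \<epsilon> \<delta>))"
      unfolding r_def sum_mult_assoc[symmetric] by (simp add: left_diff_distrib sum_subtractf)
    also have "(\<Sum>\<gamma>\<in>level k. p \<gamma> * (\<Sum>\<epsilon>\<in>below (Suc k). S \<gamma> \<epsilon> * G \<epsilon> \<delta>)) = 0"
      using that by (intro sum.neutral) (auto simp: block_cholesky_orthogonal[OF assms(1)])
    finally show ?thesis using that assms(3) by simp
  qed
  then have "r \<epsilon> = 0" if "mdeg \<epsilon> < k" for \<epsilon>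
    using block_cholesky_nondegenerate[OF assms(1)] that by blast
  then have "r \<epsilon> = 0" using high by (cases "mdeg \<epsilon> < k") auto
  then show ?thesis by (simp add: r_def)
qed

subsection \<open>Contiguous factorizations\<close>

lemma dotLam_nonzero_mdeg: "dotLam n \<gamma> \<epsilon> \<noteq> 0 \<Longrightarrow> mdeg \<epsilon> = Suc (mdeg \<gamma>)"
  by (auto simp: dotLam_def Lam_def elim!: sum.not_neutral_contains_not_neutral split: if_splits)

lemma sum_dotLam:
  fixes n :: "real ^ 'd::finite"
  assumes "mdeg \<gamma> < k"
  shows "(\<Sum>\<epsilon>\<in>below (Suc k). dotLam n \<gamma> \<epsilon> * f \<epsilon>) = (\<Sum>b\<in>UNIV. n $ b * f (\<gamma> + axis b 1))"
proof -
  have "(\<Sum>\<epsilon>\<in>below (Suc k). dotLam n \<gamma> \<epsilon> * f \<epsilon>)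
      = (\<Sum>\<epsilon>\<in>below (Suc k). (\<Sum>b\<in>UNIV. n $ b * Lam b \<gamma> \<epsilon>) * f \<epsilon>)"
    by (simp add: dotLam_def)
  also have "\<dots> = (\<Sum>b\<in>UNIV. n $ b * (\<Sum>\<epsilon>\<in>below (Suc k). Lam b \<gamma> \<epsilon> * f \<epsilon>))"
    by (rule sum_mult_assoc)
  also have "\<dots> = (\<Sum>b\<in>UNIV. n $ b * f (\<gamma> + axis b 1))"
    unfolding Lam_def using assms by (intro sum.cong arg_cong2[of _ _ _ _ "(*)"] sum_delta_below) auto
  finally show ?thesis .
qed

text \<open>An algebraic model of one lattice step: \<open>shift\<close> is the effect on the
  moments of multiplying the measure by n \<cdot> x - q, and \<open>hankel\<close> lets a factor x_b
  move between the two sides of a pairing.\<close>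

locale contiguous_factorizations =
  fixes G S H G' S' H' :: "'d::finite smat" and n :: "real ^ 'd" and q :: real
  assumes chol: "block_cholesky G S H" and chol': "block_cholesky G' S' H'"
    and shift: "\<And>\<gamma> \<delta>. G' \<gamma> \<delta> = (\<Sum>b\<in>UNIV. n $ b * G \<gamma> (\<delta> + axis b 1)) - q * G \<gamma> \<delta>"
    and hankel: "\<And>\<gamma> \<delta> b. G (\<gamma> + axis b 1) \<delta> = G \<gamma> (\<delta> + axis b 1)"
begin

lemma sum_shift:
  "(\<Sum>\<gamma>\<in>I. p \<gamma> * G' \<gamma> \<delta>)
    = (\<Sum>b\<in>UNIV. n $ b * (\<Sum>\<gamma>\<in>I. p \<gamma> * G \<gamma> (\<delta> + axis b 1))) - q * (\<Sum>\<gamma>\<in>I. p \<gamma> * G \<gamma> \<delta>)"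
proof -
  have "(\<Sum>b\<in>UNIV. n $ b * (\<Sum>\<gamma>\<in>I. p \<gamma> * G \<gamma> (\<delta> + axis b 1)))
      = (\<Sum>\<gamma>\<in>I. p \<gamma> * (\<Sum>b\<in>UNIV. n $ b * G \<gamma> (\<delta> + axis b 1)))"
    unfolding sum_distrib_left by (subst sum.swap) (simp add: mult.left_commute)
  then show ?thesis
    by (simp add: shift right_diff_distrib sum_subtractf sum_distrib_left mult.left_commute)
qed

lemmas lower = block_cholesky_lower[OF chol] block_cholesky_lower[OF chol']

text \<open>Let P and P' be the polynomials with coefficient rows \<open>S\<close> and
  \<open>S'\<close>. Both are monic, so P'_\<alpha> - P_\<alpha> has degree at most
  \<open>k\<close>. Pairing P_\<alpha> with x^\<delta> for the new measure is pairing it with (n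
  \<cdot> x - q) x^\<delta> for the old one, which has degree at most \<open>k\<close> if \<delta>
  has degree below \<open>k\<close>. Hence the difference is orthogonal to all degrees below
  \<open>k\<close> and expands in the P'_\<gamma> of degree \<open>k\<close>.\<close>

lemma contiguity:
  assumes "mdeg \<alpha> = Suc k"
  shows "S' \<alpha> \<epsilon> - S \<alpha> \<epsilon> = (\<Sum>\<gamma>\<in>level k. (S' \<alpha> \<gamma> - S \<alpha> \<gamma>) * S' \<gamma> \<epsilon>)"
proof (rule block_cholesky_expansion[OF chol'])
  show "S' \<alpha> \<gamma> - S \<alpha> \<gamma> = 0" if "k < mdeg \<gamma>" for \<gamma>
    using that assms by (simp add: lower)
  then have "(\<Sum>\<gamma>\<in>below (Suc k). (S' \<alpha> \<gamma> - S \<alpha> \<gamma>) * G' \<gamma> \<delta>)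
      = (\<Sum>\<gamma>\<in>below (Suc (Suc k)). (S' \<alpha> \<gamma> - S \<alpha> \<gamma>) * G' \<gamma> \<delta>)" for \<delta>
    by (intro sum.mono_neutral_left) auto
  also have "\<dots> \<delta> = (\<Sum>\<gamma>\<in>below (Suc (Suc k)). S' \<alpha> \<gamma> * G' \<gamma> \<delta>)
      - (\<Sum>\<gamma>\<in>below (Suc (Suc k)). S \<alpha> \<gamma> * G' \<gamma> \<delta>)" for \<delta>
    by (simp add: left_diff_distrib sum_subtractf)
  finally show "(\<Sum>\<gamma>\<in>below (Suc k). (S' \<alpha> \<gamma> - S \<alpha> \<gamma>) * G' \<gamma> \<delta>) = 0" if "mdeg \<delta> < k" for \<delta>
    using that assms
    by (simp del: One_nat_def add: sum_shift[of "S \<alpha>"] block_cholesky_orthogonal[OF chol] block_cholesky_orthogonal[OF chol'])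
qed

text \<open>
  Row \<open>\<gamma>\<close>, of degree \<open>k\<close>, holds the coefficients of
  \<open>(n \<cdot> x - q) P'\<^sub>\<gamma> - (n \<cdot> \<Lambda>) P\<close>, with \<open>P = S \<chi>\<close> and \<open>P' = S' \<chi>\<close>.
\<close>

definition residue :: "nat \<Rightarrow> 'd smat" where
  "residue k \<gamma> \<epsilon> = (\<Sum>\<zeta>\<in>below (Suc k). S' \<gamma> \<zeta> * dotLam n \<zeta> \<epsilon>) - q * S' \<gamma> \<epsilon>
     - (\<Sum>\<zeta>\<in>level (Suc k). dotLam n \<gamma> \<zeta> * S \<zeta> \<epsilon>)"

text \<open>Both polynomials have leading part (n \<cdot> x) x^\<gamma> because \<open>S\<close> and
  \<open>S'\<close> are unitriangular. Their difference therefore has degree at most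
  \<open>k\<close>, within reach of nondegeneracy on \<open>below (Suc k)\<close>.\<close>

lemma residue_top:
  assumes "mdeg \<gamma> = k" and "mdeg \<epsilon> = Suc k"
  shows "residue k \<gamma> \<epsilon> = 0"
proof -
  have "(\<Sum>\<zeta>\<in>below (Suc k). S' \<gamma> \<zeta> * dotLam n \<zeta> \<epsilon>)
      = (\<Sum>\<zeta>\<in>below (Suc k). (if \<gamma> = \<zeta> then 1 else 0) * dotLam n \<zeta> \<epsilon>)"
  proof (intro sum.cong refl)
    fix \<zeta> :: "'d mindex"
    show "S' \<gamma> \<zeta> * dotLam n \<zeta> \<epsilon> = (if \<gamma> = \<zeta> then 1 else 0) * dotLam n \<zeta> \<epsilon>"
      using assms dotLam_nonzero_mdeg[of n \<zeta> \<epsilon>] lower(2)[of \<gamma> \<zeta>] by (cases "dotLam n \<zeta> \<epsilon> = 0") auto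
  qed
  also have "\<dots> = dotLam n \<gamma> \<epsilon>" using assms by (intro sum_delta_below) simp
  finally have 1: "(\<Sum>\<zeta>\<in>below (Suc k). S' \<gamma> \<zeta> * dotLam n \<zeta> \<epsilon>) = dotLam n \<gamma> \<epsilon>" .
  have "(\<Sum>\<zeta>\<in>level (Suc k). dotLam n \<gamma> \<zeta> * S \<zeta> \<epsilon>)
      = (\<Sum>\<zeta>\<in>level (Suc k). if \<zeta> = \<epsilon> then dotLam n \<gamma> \<zeta> else 0)"
    using assms by (intro sum.cong) (auto simp: lower)
  then have 2: "(\<Sum>\<zeta>\<in>level (Suc k). dotLam n \<gamma> \<zeta> * S \<zeta> \<epsilon>) = dotLam n \<gamma> \<epsilon>"
    using assms by simp
  show ?thesis unfolding residue_def 1 2 using assms by (auto simp: lower)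
qed

text \<open>By the Hankel symmetry and \<open>shift\<close>, pairing (n \<cdot> x - q) P'_\<gamma>
  with x^\<delta> under \<open>G\<close> is pairing P'_\<gamma> with x^\<delta> under
  \<open>G'\<close>. The subtracted part consists of rows of \<open>S\<close> of degree
  \<open>k + 1\<close>, which are orthogonal to x^\<delta>.\<close>

lemma residue_pairing:
  assumes "mdeg \<gamma> = k" and "mdeg \<delta> < Suc k"
  shows "(\<Sum>\<epsilon>\<in>below (Suc k). residue k \<gamma> \<epsilon> * G \<epsilon> \<delta>) = (\<Sum>\<epsilon>\<in>below (Suc k). S' \<gamma> \<epsilon> * G' \<epsilon> \<delta>)"
proof -
  let ?U = "below (Suc (Suc k)) :: 'd mindex set"
  have "(\<Sum>\<epsilon>\<in>below (Suc k). residue k \<gamma> \<epsilon> * G \<epsilon> \<delta>) = (\<Sum>\<epsilon>\<in>?U. residue k \<gamma> \<epsilon> * G \<epsilon> \<delta>)"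
    using assms by (intro sum_below_Suc[symmetric]) (simp add: residue_top)
  also have "\<dots> = (\<Sum>\<epsilon>\<in>?U. (\<Sum>\<zeta>\<in>below (Suc k). S' \<gamma> \<zeta> * dotLam n \<zeta> \<epsilon>) * G \<epsilon> \<delta>)
      - q * (\<Sum>\<epsilon>\<in>?U. S' \<gamma> \<epsilon> * G \<epsilon> \<delta>)
      - (\<Sum>\<epsilon>\<in>?U. (\<Sum>\<zeta>\<in>level (Suc k). dotLam n \<gamma> \<zeta> * S \<zeta> \<epsilon>) * G \<epsilon> \<delta>)"
    by (simp add: residue_def left_diff_distrib sum_subtractf sum_distrib_left mult.assoc)
  also have "(\<Sum>\<epsilon>\<in>?U. (\<Sum>\<zeta>\<in>level (Suc k). dotLam n \<gamma> \<zeta> * S \<zeta> \<epsilon>) * G \<epsilon> \<delta>) = 0"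
    unfolding sum_mult_assoc using assms
    by (intro sum.neutral) (auto simp: block_cholesky_orthogonal[OF chol])
  also have "(\<Sum>\<epsilon>\<in>?U. (\<Sum>\<zeta>\<in>below (Suc k). S' \<gamma> \<zeta> * dotLam n \<zeta> \<epsilon>) * G \<epsilon> \<delta>)
      = (\<Sum>\<zeta>\<in>below (Suc k). S' \<gamma> \<zeta> * (\<Sum>b\<in>UNIV. n $ b * G \<zeta> (\<delta> + axis b 1)))"
    unfolding sum_mult_assoc by (intro sum.cong) (auto simp: sum_dotLam hankel[simplified])
  also have "(\<Sum>\<epsilon>\<in>?U. S' \<gamma> \<epsilon> * G \<epsilon> \<delta>) = (\<Sum>\<epsilon>\<in>below (Suc k). S' \<gamma> \<epsilon> * G \<epsilon> \<delta>)"
    using assms by (intro sum_below_Suc) (auto simp: lower)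
  finally show ?thesis
    by (simp add: shift right_diff_distrib sum_subtractf sum_distrib_left mult.left_commute)
qed

text \<open>\<open>D\<close> stands for the derivative of row \<alpha> of \<open>S\<close>, and its
  hypothesis is the differentiated orthogonality relation. Both sides pair equally with every
  x^\<delta> of degree at most \<open>k\<close>: by contiguity the right side pairs like P'_\<alpha>
  - P_\<alpha> under \<open>G'\<close>, where P'_\<alpha> contributes nothing and P_\<alpha> gives
  the prescribed value. Nondegeneracy of \<open>G\<close> then identifies the two.\<close>

lemma derivative_row:
  assumes \<alpha>: "mdeg \<alpha> = Suc k" and \<epsilon>: "mdeg \<epsilon> < Suc k"
    and D: "\<And>\<delta>. mdeg \<delta> < Suc k \<Longrightarrow> (\<Sum>\<gamma>\<in>below (Suc k). D \<gamma> * G \<gamma> \<delta>)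
      = - (\<Sum>b\<in>UNIV. n $ b * (\<Sum>\<gamma>\<in>below (Suc (Suc k)). S \<alpha> \<gamma> * G \<gamma> (\<delta> + axis b 1)))"
  shows "D \<epsilon> = (\<Sum>\<gamma>\<in>level k. (S' \<alpha> \<gamma> - S \<alpha> \<gamma>) * residue k \<gamma> \<epsilon>)"
proof -
  let ?\<Delta> = "\<lambda>\<gamma>. S' \<alpha> \<gamma> - S \<alpha> \<gamma>"
  have "(\<Sum>\<epsilon>\<in>below (Suc k). (D \<epsilon> - (\<Sum>\<gamma>\<in>level k. ?\<Delta> \<gamma> * residue k \<gamma> \<epsilon>)) * G \<epsilon> \<delta>) = 0"
    if \<delta>: "mdeg \<delta> < Suc k" for \<delta>
  proof -
    have "(\<Sum>\<epsilon>\<in>below (Suc k). (\<Sum>\<gamma>\<in>level k. ?\<Delta> \<gamma> * residue k \<gamma> \<epsilon>) * G \<epsilon> \<delta>)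
        = (\<Sum>\<gamma>\<in>level k. ?\<Delta> \<gamma> * (\<Sum>\<epsilon>\<in>below (Suc k). S' \<gamma> \<epsilon> * G' \<epsilon> \<delta>))"
      unfolding sum_mult_assoc using \<delta> by (intro sum.cong) (auto simp: residue_pairing)
    also have "\<dots> = (\<Sum>\<gamma>\<in>level k. ?\<Delta> \<gamma> * (\<Sum>\<epsilon>\<in>below (Suc (Suc k)). S' \<gamma> \<epsilon> * G' \<epsilon> \<delta>))"
      by (intro sum.cong arg_cong2[of _ _ _ _ "(*)"] sum_below_Suc[symmetric]) (auto simp: lower)
    also have "\<dots> = (\<Sum>\<epsilon>\<in>below (Suc (Suc k)). ?\<Delta> \<epsilon> * G' \<epsilon> \<delta>)"
      by (simp add: sum_mult_assoc[symmetric] contiguity[OF \<alpha>, symmetric])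
    also have "\<dots> = - (\<Sum>\<epsilon>\<in>below (Suc (Suc k)). S \<alpha> \<epsilon> * G' \<epsilon> \<delta>)"
      using \<alpha> \<delta> by (simp add: left_diff_distrib sum_subtractf block_cholesky_orthogonal[OF chol'])
    also have "\<dots> = (\<Sum>\<gamma>\<in>below (Suc k). D \<gamma> * G \<gamma> \<delta>)"
      using \<alpha> \<delta> by (simp del: One_nat_def add: sum_shift D block_cholesky_orthogonal[OF chol])
    finally show ?thesis by (simp add: left_diff_distrib sum_subtractf)
  qed
  from block_cholesky_nondegenerate[OF chol this \<epsilon>] show ?thesis by simp
qed

text \<open>This is \<open>derivative_row\<close> in degree \<open>k\<close> with the residue
  written out; contiguity collapses the two sums containing \<open>S'\<close>. On the right only
  \<zeta> of degree \<open>k - 1\<close> contributes, so the differences there are those of the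
  second subdiagonal of \<open>S\<close>.\<close>

lemma toda_row:
  assumes \<alpha>: "mdeg \<alpha> = Suc k" and \<epsilon>: "mdeg \<epsilon> = k"
    and D: "\<And>\<delta>. mdeg \<delta> < Suc k \<Longrightarrow> (\<Sum>\<gamma>\<in>below (Suc k). D \<gamma> * G \<gamma> \<delta>)
      = - (\<Sum>b\<in>UNIV. n $ b * (\<Sum>\<gamma>\<in>below (Suc (Suc k)). S \<alpha> \<gamma> * G \<gamma> (\<delta> + axis b 1)))"
  shows "D \<epsilon> + (S' \<alpha> \<epsilon> - S \<alpha> \<epsilon>) * q
      + (\<Sum>\<gamma>\<in>level k. (S' \<alpha> \<gamma> - S \<alpha> \<gamma>) * (\<Sum>\<zeta>\<in>level (Suc k). dotLam n \<gamma> \<zeta> * S \<zeta> \<epsilon>))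
    = (\<Sum>\<zeta>\<in>below (Suc k). (S' \<alpha> \<zeta> - S \<alpha> \<zeta>) * dotLam n \<zeta> \<epsilon>)"
proof -
  let ?\<Delta> = "\<lambda>\<gamma>. S' \<alpha> \<gamma> - S \<alpha> \<gamma>"
  have expand: "(\<Sum>\<gamma>\<in>level k. c \<gamma> * residue k \<gamma> \<epsilon>)
      = (\<Sum>\<gamma>\<in>level k. c \<gamma> * (\<Sum>\<zeta>\<in>below (Suc k). S' \<gamma> \<zeta> * dotLam n \<zeta> \<epsilon>))
      - (\<Sum>\<gamma>\<in>level k. c \<gamma> * S' \<gamma> \<epsilon>) * q
      - (\<Sum>\<gamma>\<in>level k. c \<gamma> * (\<Sum>\<zeta>\<in>level (Suc k). dotLam n \<gamma> \<zeta> * S \<zeta> \<epsilon>))" for c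
    by (simp add: residue_def right_diff_distrib sum_subtractf sum_distrib_left mult_ac)
  have "D \<epsilon> = (\<Sum>\<gamma>\<in>level k. ?\<Delta> \<gamma> * residue k \<gamma> \<epsilon>)"
    using derivative_row[OF \<alpha> _ D] \<epsilon> by simp
  also note expand[of ?\<Delta>]
  also have "(\<Sum>\<gamma>\<in>level k. ?\<Delta> \<gamma> * S' \<gamma> \<epsilon>) = ?\<Delta> \<epsilon>"
    by (rule contiguity[OF \<alpha>, symmetric])
  also have "(\<Sum>\<gamma>\<in>level k. ?\<Delta> \<gamma> * (\<Sum>\<zeta>\<in>below (Suc k). S' \<gamma> \<zeta> * dotLam n \<zeta> \<epsilon>))
      = (\<Sum>\<zeta>\<in>below (Suc k). ?\<Delta> \<zeta> * dotLam n \<zeta> \<epsilon>)"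
    by (simp add: sum_mult_assoc[symmetric] contiguity[OF \<alpha>, symmetric])
  finally show ?thesis by simp
qed

end

subsection \<open>Differentiability\<close>

text \<open>The entries of a row of \<open>S\<close> below the diagonal solve the orthogonality
  equations, whose coefficients are moments. This lemma transfers differentiability from the moments
  to \<open>S\<close>.\<close>

lemma linear_system_differentiable:
  fixes p v :: "real \<Rightarrow> 'i \<Rightarrow> real" and g :: "real \<Rightarrow> 'i \<Rightarrow> 'i \<Rightarrow> real"
  assumes I: "finite I"
    and sys: "\<And>s j. j \<in> I \<Longrightarrow> (\<Sum>i\<in>I. p s i * g s i j) = v s j"
    and K: "\<And>i k. i \<in> I \<Longrightarrow> k \<in> I \<Longrightarrow> (\<Sum>j\<in>I. g s0 i j * K j k) = (if i = k then 1 else 0)"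
    and g: "\<And>i j. i \<in> I \<Longrightarrow> j \<in> I \<Longrightarrow> (\<lambda>s. g s i j) differentiable (at s0)"
    and v: "\<And>j. j \<in> I \<Longrightarrow> (\<lambda>s. v s j) differentiable (at s0)"
    and k: "k \<in> I"
  shows "(\<lambda>s. p s k) differentiable (at s0)"
proof -
  define e where "e s i k = (\<Sum>j\<in>I. (g s i j - g s0 i j) * K j k)" for s i k
  define w where "w s k = (\<Sum>j\<in>I. v s j * K j k)" for s k
  \<comment> \<open>With \<open>w = v K\<close> and \<open>e = (g - g s0) K\<close>, which vanishes at \<open>s0\<close>, this bounds \<open>p\<close> near \<open>s0\<close>,
    then shows that it is continuous, and finally that it is differentiable.\<close>
  have fixpoint: "p s k = w s k - (\<Sum>i\<in>I. p s i * e s i k)" if k: "k \<in> I" for s k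
  proof -
    have "w s k = (\<Sum>j\<in>I. (\<Sum>i\<in>I. p s i * g s i j) * K j k)"
      unfolding w_def by (simp add: sys)
    also have "\<dots> = (\<Sum>i\<in>I. p s i * ((if i = k then 1 else 0) + e s i k))"
      unfolding sum_mult_assoc e_def using k
      by (intro sum.cong) (auto simp: K[symmetric] sum.distrib[symmetric] algebra_simps)
    also have "\<dots> = (\<Sum>i\<in>I. if i = k then p s i else 0) + (\<Sum>i\<in>I. p s i * e s i k)"
      unfolding sum.distrib[symmetric] by (intro sum.cong) (auto simp: algebra_simps)
    also have "(\<Sum>i\<in>I. if i = k then p s i else 0) = p s k" using k I by simp
    finally show ?thesis by simp
  qed
  have e_diff: "(\<lambda>s. e s i k) differentiable (at s0)" if "i \<in> I" for i k
    unfolding e_def using that by (intro differentiable_sum I ballI differentiable_mult differentiable_diff g differentiable_const)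
  have w_diff: "(\<lambda>s. w s k) differentiable (at s0)" for k
    unfolding w_def by (intro differentiable_sum I ballI differentiable_mult v differentiable_const)
  have cont: "(f \<longlongrightarrow> f s0) (at s0)" if "f differentiable (at s0)" for f :: "real \<Rightarrow> real"
    using that differentiable_imp_continuous_within continuous_within by blast
  have e0: "e s0 i k = 0" for i k by (simp add: e_def)
  have e_lim: "((\<lambda>s. e s i k) \<longlongrightarrow> 0) (at s0)" if "i \<in> I" for i k
    using cont[OF e_diff[OF that, of k]] by (simp add: e0)
  define P where "P s = (\<Sum>i\<in>I. \<bar>p s i\<bar>)" for s
  define W where "W s = (\<Sum>k\<in>I. \<bar>w s k\<bar>)" for s
  define \<epsilon> where "\<epsilon> s = (\<Sum>k\<in>I. \<Sum>i\<in>I. \<bar>e s i k\<bar>)" for s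
  have \<epsilon>_nonneg: "0 \<le> \<epsilon> s" for s unfolding \<epsilon>_def by (intro sum_nonneg) auto
  have P_nonneg: "0 \<le> P s" for s unfolding P_def by (intro sum_nonneg) auto
  have pe: "(\<Sum>i\<in>I. \<bar>p s i * e s i k\<bar>) \<le> P s * (\<Sum>i\<in>I. \<bar>e s i k\<bar>)" for s k
  proof -
    have "(\<Sum>i\<in>I. \<bar>p s i * e s i k\<bar>) \<le> (\<Sum>i\<in>I. P s * \<bar>e s i k\<bar>)"
      unfolding P_def abs_mult using I by (intro sum_mono mult_right_mono member_le_sum) auto
    then show ?thesis by (simp add: sum_distrib_left)
  qed
  have P_le: "P s \<le> W s + P s * \<epsilon> s" for s
  proof -
    have "P s \<le> (\<Sum>k\<in>I. \<bar>w s k\<bar> + P s * (\<Sum>i\<in>I. \<bar>e s i k\<bar>))"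
      unfolding P_def
    proof (intro sum_mono)
      fix k assume "k \<in> I"
      then have "\<bar>p s k\<bar> \<le> \<bar>w s k\<bar> + \<bar>\<Sum>i\<in>I. p s i * e s i k\<bar>" using fixpoint by simp
      also have "\<bar>\<Sum>i\<in>I. p s i * e s i k\<bar> \<le> (\<Sum>i\<in>I. \<bar>p s i * e s i k\<bar>)" by (rule sum_abs)
      finally show "\<bar>p s k\<bar> \<le> \<bar>w s k\<bar> + (\<Sum>i\<in>I. \<bar>p s i\<bar>) * (\<Sum>i\<in>I. \<bar>e s i k\<bar>)"
        using pe[of s k] by (simp add: P_def)
    qed
    then show ?thesis by (simp add: W_def \<epsilon>_def sum.distrib sum_distrib_left)
  qed
  \<comment> \<open>Near \<open>s0\<close> one has \<open>W s < W s0 + 1\<close> and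
    \<open>\<epsilon> s < 1 / 2\<close>, so \<open>P_le\<close> absorbs half of \<open>P s\<close>
    and bounds it by \<open>2 * (W s0 + 1)\<close>.\<close>
  have "(W \<longlongrightarrow> W s0) (at s0)" unfolding W_def by (intro tendsto_intros cont w_diff)
  then have W_ev: "\<forall>\<^sub>F s in at s0. W s < W s0 + 1" by (rule order_tendstoD) simp
  have "(\<epsilon> \<longlongrightarrow> (\<Sum>k\<in>I. \<Sum>i\<in>I. \<bar>0\<bar>)) (at s0)" unfolding \<epsilon>_def by (intro tendsto_intros e_lim)
  then have "\<forall>\<^sub>F s in at s0. \<epsilon> s < 1 / 2" by (rule order_tendstoD) simp
  with W_ev have P_ev: "\<forall>\<^sub>F s in at s0. P s \<le> 2 * (W s0 + 1)"
  proof eventually_elim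
    case (elim s)
    have "P s * \<epsilon> s \<le> P s * (1 / 2)" using elim P_nonneg by (intro mult_left_mono) auto
    then show ?case using P_le[of s] elim by simp
  qed
  have p_cont: "isCont (\<lambda>s. p s k) s0" if k: "k \<in> I" for k
  proof -
    have "((\<lambda>s. \<Sum>i\<in>I. p s i * e s i k) \<longlongrightarrow> 0) (at s0)"
    proof (rule Lim_null_comparison)
      show "((\<lambda>s. 2 * (W s0 + 1) * (\<Sum>i\<in>I. \<bar>e s i k\<bar>)) \<longlongrightarrow> 0) (at s0)"
        using e_lim by (intro tendsto_eq_intros refl tendsto_eq_rhs[OF tendsto_sum] tendsto_rabs) auto
      show "\<forall>\<^sub>F s in at s0. norm (\<Sum>i\<in>I. p s i * e s i k) \<le> 2 * (W s0 + 1) * (\<Sum>i\<in>I. \<bar>e s i k\<bar>)"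
        using P_ev
      proof eventually_elim
        case (elim s)
        have "norm (\<Sum>i\<in>I. p s i * e s i k) \<le> P s * (\<Sum>i\<in>I. \<bar>e s i k\<bar>)"
          unfolding real_norm_def by (rule order_trans[OF sum_abs pe])
        also have "\<dots> \<le> 2 * (W s0 + 1) * (\<Sum>i\<in>I. \<bar>e s i k\<bar>)"
          using elim by (intro mult_right_mono sum_nonneg) auto
        finally show ?case .
      qed
    qed
    from tendsto_diff[OF cont[OF w_diff] this, of k] have "((\<lambda>s. p s k) \<longlongrightarrow> w s0 k) (at s0)"
      using k by (simp add: fixpoint[symmetric])
    moreover have "w s0 k = p s0 k" using fixpoint[OF k, of s0] by (simp add: e0)
    ultimately show ?thesis by (simp add: isCont_def)
  qed
  \<comment> \<open>Caratheodory's form of the derivative: \<open>e\<close> vanishes at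
    \<open>s0\<close>, hence is \<open>s - s0\<close> times a function continuous at
    \<open>s0\<close>. Continuity of \<open>p\<close> there is then enough to make the product
    \<open>p * e\<close> differentiable.\<close>
  have "\<exists>c. (\<forall>s. e s i k = c s * (s - s0)) \<and> isCont c s0" if "i \<in> I" for i
    using e_diff[OF that, of k] e0 unfolding real_differentiable_def CARAT_DERIV by auto
  then obtain c where c: "\<And>i s. i \<in> I \<Longrightarrow> e s i k = c i s * (s - s0)" "\<And>i. i \<in> I \<Longrightarrow> isCont (c i) s0"
    by metis
  have "(\<lambda>s. \<Sum>i\<in>I. p s i * e s i k) differentiable (at s0)"
  proof (intro differentiable_sum I ballI)
    fix i assume i: "i \<in> I"
    have "((\<lambda>s. p s i * e s i k) has_real_derivative p s0 i * c i s0) (at s0)"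
      unfolding CARAT_DERIV using i
      by (intro exI[of _ "\<lambda>s. p s i * c i s"]) (auto simp: c e0 intro!: continuous_intros p_cont)
    then show "(\<lambda>s. p s i * e s i k) differentiable (at s0)"
      by (auto simp: real_differentiable_def)
  qed
  then have "(\<lambda>s. w s k - (\<Sum>i\<in>I. p s i * e s i k)) differentiable (at s0)"
    by (intro differentiable_diff w_diff)
  then show ?thesis using k by (simp add: fixpoint[symmetric])
qed

section \<open>Differentiation under the integral sign\<close>

lemma abs_exp_minus_linear_le: "\<bar>exp y - 1 - y\<bar> \<le> y\<^sup>2 * exp \<bar>y\<bar>" for y :: real
proof -
  obtain t where t: "\<bar>t\<bar> \<le> \<bar>y\<bar>" "exp y = 1 + y + exp t / 2 * y\<^sup>2"
    using Maclaurin_exp_le[of y 2] by (auto simp: numeral_2_eq_2)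
  have "exp t / 2 * y\<^sup>2 \<le> exp \<bar>y\<bar> * y\<^sup>2"
  proof (rule mult_right_mono)
    have "exp t \<le> exp \<bar>y\<bar>" using t by simp
    then show "exp t / 2 \<le> exp \<bar>y\<bar>" using exp_gt_zero[of t] by linarith
  qed simp
  then show ?thesis using t by (simp add: mult.commute)
qed

lemma integrable_mult_bounded:
  fixes f g :: "'a \<Rightarrow> real"
  assumes "integrable M f" and "g \<in> borel_measurable M" and "AE x in M. \<bar>g x\<bar> \<le> B"
  shows "integrable M (\<lambda>x. f x * g x)"
proof (rule Bochner_Integration.integrable_bound)
  show "integrable M (\<lambda>x. B * \<bar>f x\<bar>)" using assms by simp
  show "(\<lambda>x. f x * g x) \<in> borel_measurable M" using assms by measurable
  show "AE x in M. norm (f x * g x) \<le> norm (B * \<bar>f x\<bar>)"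
    using assms(3)
  proof eventually_elim
    case (elim x)
    then have "0 \<le> B" by linarith
    with elim show ?case by (simp add: abs_mult) (metis abs_ge_zero mult.commute mult_right_mono)
  qed
qed

text \<open>For \<open>\<bar>h\<bar> \<le> 1\<close> and \<open>\<bar>u x\<bar> \<le> B\<close>, the
  second-order remainder of \<open>exp (h * u x)\<close> is at most
  \<open>h\<^sup>2 * B\<^sup>2 * exp B\<close>. Integrated against \<open>\<bar>f\<bar>\<close>,
  this puts the difference quotient within \<open>\<bar>h\<bar> * C\<close> of the claimed
  derivative.\<close>

lemma has_real_derivative_integral_exp:
  fixes f u :: "'a \<Rightarrow> real"
  assumes f: "integrable M f" and u [measurable]: "u \<in> borel_measurable M"
    and B: "AE x in M. \<bar>u x\<bar> \<le> B"
  shows "((\<lambda>s. LINT x|M. f x * exp ((s - s0) * u x)) has_real_derivative (LINT x|M. f x * u x)) (at s0)"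
proof -
  have exp_int: "integrable M (\<lambda>x. f x * exp (h * u x))" for h
  proof (rule integrable_mult_bounded[OF f])
    show "AE x in M. \<bar>exp (h * u x)\<bar> \<le> exp (\<bar>h\<bar> * B)"
      using B
    proof eventually_elim
      case (elim x)
      have "h * u x \<le> \<bar>h\<bar> * \<bar>u x\<bar>" by (simp add: abs_mult[symmetric])
      also have "\<dots> \<le> \<bar>h\<bar> * B" using elim by (intro mult_left_mono) auto
      finally show ?case by simp
    qed
  qed measurable
  have u_int: "integrable M (\<lambda>x. f x * u x)" by (rule integrable_mult_bounded[OF f u B])
  define C where "C = (LINT x|M. \<bar>f x\<bar> * (B\<^sup>2 * exp B))"
  define F where "F h = (LINT x|M. f x * exp (h * u x))" for h
  define L where "L = (LINT x|M. f x * u x)"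
  have remainder: "\<bar>F h - F 0 - h * L\<bar> \<le> h\<^sup>2 * C" if h: "\<bar>h\<bar> \<le> 1" for h
  proof -
    have "F h - F 0 - h * L = (LINT x|M. f x * (exp (h * u x) - 1 - h * u x))"
      unfolding F_def L_def using exp_int[of h] f u_int
      by (simp add: algebra_simps Bochner_Integration.integral_diff)
    also have "\<bar>\<dots>\<bar> \<le> (LINT x|M. \<bar>f x * (exp (h * u x) - 1 - h * u x)\<bar>)"
      using integral_norm_bound[of M "\<lambda>x. f x * (exp (h * u x) - 1 - h * u x)"] by simp
    also have "\<dots> \<le> (LINT x|M. h\<^sup>2 * (\<bar>f x\<bar> * (B\<^sup>2 * exp B)))"
    proof (rule integral_mono_AE)
      have "integrable M (\<lambda>x. f x * (exp (h * u x) - 1 - h * u x))"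
        using exp_int[of h] f u_int by (simp add: algebra_simps)
      then show "integrable M (\<lambda>x. \<bar>f x * (exp (h * u x) - 1 - h * u x)\<bar>)" by simp
      show "integrable M (\<lambda>x. h\<^sup>2 * (\<bar>f x\<bar> * (B\<^sup>2 * exp B)))" using f by simp
      show "AE x in M. \<bar>f x * (exp (h * u x) - 1 - h * u x)\<bar> \<le> h\<^sup>2 * (\<bar>f x\<bar> * (B\<^sup>2 * exp B))"
        using B
      proof eventually_elim
        case (elim x)
        have "\<bar>exp (h * u x) - 1 - h * u x\<bar> \<le> (h * u x)\<^sup>2 * exp \<bar>h * u x\<bar>"
          by (rule abs_exp_minus_linear_le)
        also have "\<dots> \<le> (h\<^sup>2 * B\<^sup>2) * exp B"
        proof (rule mult_mono)
          have "(u x)\<^sup>2 \<le> B\<^sup>2" using elim by (simp add: abs_le_square_iff[symmetric])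
          then show "(h * u x)\<^sup>2 \<le> h\<^sup>2 * B\<^sup>2" by (simp add: power_mult_distrib mult_left_mono)
          have "\<bar>h * u x\<bar> \<le> 1 * B" unfolding abs_mult using elim h by (intro mult_mono) auto
          then show "exp \<bar>h * u x\<bar> \<le> exp B" by simp
        qed auto
        finally have "\<bar>f x\<bar> * \<bar>exp (h * u x) - 1 - h * u x\<bar> \<le> \<bar>f x\<bar> * ((h\<^sup>2 * B\<^sup>2) * exp B)"
          by (intro mult_left_mono) auto
        then show ?case by (simp add: abs_mult mult_ac)
      qed
    qed
    also have "\<dots> = h\<^sup>2 * C" by (simp add: C_def)
    finally show ?thesis .
  qed
  have "((\<lambda>h. (F h - F 0) / h) \<longlongrightarrow> L) (at 0)"
  proof (rule Lim_transform2[OF tendsto_const], rule Lim_null_comparison)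
    show "((\<lambda>h. \<bar>h\<bar> * C) \<longlongrightarrow> 0) (at 0)" by (intro tendsto_eq_intros refl) auto
    have "\<forall>\<^sub>F h in at (0::real). \<bar>h\<bar> < 1 \<and> h \<noteq> 0"
      unfolding eventually_at by (intro exI[of _ 1]) auto
    then show "\<forall>\<^sub>F h in at 0. norm (L - (F h - F 0) / h) \<le> \<bar>h\<bar> * C"
    proof eventually_elim
      case (elim h)
      then have "L - (F h - F 0) / h = - ((F h - F 0 - h * L) / h)" by (simp add: field_simps)
      then have "norm (L - (F h - F 0) / h) = \<bar>F h - F 0 - h * L\<bar> / \<bar>h\<bar>" by simp
      also have "\<dots> \<le> h\<^sup>2 * C / \<bar>h\<bar>" using remainder[of h] elim by (intro divide_right_mono) auto
      also have "\<dots> = \<bar>h\<bar> * C" using elim by (simp add: power2_eq_square field_simps)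
      finally show ?case .
    qed
  qed
  then have "(F has_real_derivative L) (at 0)" by (simp add: DERIV_def)
  then have "((\<lambda>s. F (s - s0)) has_real_derivative L) (at s0)"
    using DERIV_shift[of "\<lambda>s. F (s - s0)" L 0 s0] by simp
  then show ?thesis by (simp add: F_def L_def)
qed

subsection \<open>The deformed moments\<close>

lemma chi_add: "chi x (\<alpha> + \<beta>) = chi x \<alpha> * chi x \<beta>"
  by (simp add: chi_def power_add prod.distrib)

lemma chi_axis: "chi x (axis c 1) = x $ c"
proof -
  have "chi x (axis c 1) = (\<Prod>i\<in>UNIV. if c = i then x $ i else 1)"
    unfolding chi_def by (intro prod.cong) (auto simp: axis_def)
  then show ?thesis by simp
qed

text \<open>Each coordinate of x is a fixed linear combination of the numbers n_a \<cdot> x, with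
  coefficients from the inverse of \<open>N\<close>, and the support condition bounds these
  numbers.\<close>

lemma AE_bounded_coordinate:
  fixes N :: "real ^ 'd ^ 'd::finite"
  assumes "invertible N" and "AE x in M. \<forall>a. \<bar>N $ a \<bullet> x\<bar> < \<bar>q $ a\<bar>"
  obtains B where "AE x in M. \<bar>x $ c\<bar> \<le> B"
proof -
  obtain L where L: "L ** N = mat 1" using assms(1) invertible_left_inverse by blast
  have x: "x $ c = (\<Sum>a\<in>UNIV. L $ c $ a * (N $ a \<bullet> x))" for x
  proof -
    have "x = L *v (N *v x)" by (simp add: matrix_vector_mul_assoc L)
    then have "x $ c = L $ c \<bullet> (N *v x)" by (metis matrix_vector_mul_component)
    then show ?thesis by (simp add: inner_vec_def[of "L $ c"] matrix_vector_mul_component)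
  qed
  have "AE x in M. \<bar>x $ c\<bar> \<le> (\<Sum>a\<in>UNIV. \<bar>L $ c $ a\<bar> * \<bar>q $ a\<bar>)"
    using assms(2)
  proof eventually_elim
    case (elim x)
    have "\<bar>x $ c\<bar> \<le> (\<Sum>a\<in>UNIV. \<bar>L $ c $ a * (N $ a \<bullet> x)\<bar>)"
      unfolding x[of x] by (rule sum_abs)
    also have "\<dots> \<le> (\<Sum>a\<in>UNIV. \<bar>L $ c $ a\<bar> * \<bar>q $ a\<bar>)"
      unfolding abs_mult using elim by (intro sum_mono mult_left_mono) (auto intro: less_imp_le)
    finally show ?case .
  qed
  then show thesis by (rule that)
qed

text \<open>The two series differ in the single term of index \<open>axis c 1\<close>, whose
  monomial is the coordinate x_c.\<close>

lemma summable_on_times_update: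
  fixes x :: "real ^ 'd::finite"
  assumes "(\<lambda>\<alpha>. t \<alpha> * chi x \<alpha>) summable_on UNIV"
  shows "(\<lambda>\<alpha>. (t(axis c 1 := s)) \<alpha> * chi x \<alpha>) summable_on UNIV" (is ?S)
    and "tfun (t(axis c 1 := s)) x = tfun t x + (s - t (axis c 1)) * x $ c" (is ?T)
proof -
  let ?e = "axis c 1 :: 'd mindex"
  have "((\<lambda>\<alpha>. (s - t ?e) * chi x \<alpha>) has_sum (\<Sum>\<alpha>\<in>{?e}. (s - t ?e) * chi x \<alpha>)) {?e}"
    by (intro has_sum_finite) simp
  then have "((\<lambda>\<alpha>. if \<alpha> = ?e then (s - t ?e) * chi x \<alpha> else 0) has_sum (s - t ?e) * x $ c) UNIV"
    unfolding chi_axis[symmetric] by (subst has_sum_cong_neutral[of "{?e}"]) auto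
  from has_sum_add[OF has_sum_infsum[OF assms] this]
  have "((\<lambda>\<alpha>. (t(?e := s)) \<alpha> * chi x \<alpha>) has_sum (tfun t x + (s - t ?e) * x $ c)) UNIV"
    unfolding tfun_def by (rule has_sum_cong[THEN iffD1, rotated]) (auto simp: algebra_simps)
  then show ?S ?T
    unfolding tfun_def by (auto dest: has_sum_imp_summable infsumI)
qed

text \<open>Where the series \<open>t(x)\<close> diverges, \<open>tfun\<close> is 0 for both \<open>t\<close> and its update.\<close>

lemma weight_times_update:
  fixes x :: "real ^ 'd::finite"
  shows "weight N q (t(axis c 1 := s)) m x = weight N q t m x *
    (if (\<lambda>\<alpha>. t \<alpha> * chi x \<alpha>) summable_on UNIV then exp ((s - t (axis c 1)) * x $ c) else 1)"
proof (cases "(\<lambda>\<alpha>. t \<alpha> * chi x \<alpha>) summable_on UNIV")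
  case True
  then show ?thesis
    by (simp add: weight_def summable_on_times_update(2)[OF True, simplified] exp_add)
next
  case False
  have "\<not> (\<lambda>\<alpha>. (t(axis c 1 := s)) \<alpha> * chi x \<alpha>) summable_on UNIV"
  proof
    assume "(\<lambda>\<alpha>. (t(axis c 1 := s)) \<alpha> * chi x \<alpha>) summable_on UNIV"
    from summable_on_times_update(1)[OF this, of c "t (axis c 1)"] False show False
      by (simp only: fun_upd_upd fun_upd_triv)
  qed
  then show ?thesis using False
    by (simp add: weight_def tfun_def infsum_not_exists)
qed

lemma chi_measurable [measurable]: "(\<lambda>x. chi x \<alpha>) \<in> borel_measurable borel"
  unfolding chi_def by measurable

text \<open>
  \<open>M\<close> need not be complete, so discarding the null set on which \<open>t(x)\<close> diverges requires that set
  to be Borel.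
\<close>

lemma measurable_summable_times:
  fixes M :: "(real ^ 'd::finite) measure"
  assumes [measurable_cong]: "sets M = sets borel"
  shows "Measurable.pred M (\<lambda>x. (\<lambda>\<alpha>. t \<alpha> * chi x \<alpha>) summable_on UNIV)"
proof -
  \<comment> \<open>A real family is summable iff its finite absolute partial sums are bounded. With
    integer bounds and countably many finite sets of multi-indices, only countable unions and
    intersections of Borel sets occur.\<close>
  have eq: "(\<lambda>\<alpha>. t \<alpha> * chi x \<alpha>) summable_on UNIV \<longleftrightarrow>
      (\<exists>C::nat. \<forall>F\<in>Collect finite. (\<Sum>\<alpha>\<in>F. \<bar>t \<alpha> * chi x \<alpha>\<bar>) \<le> real C)" for x
  proof -
    have "(\<lambda>\<alpha>. t \<alpha> * chi x \<alpha>) summable_on UNIV \<longleftrightarrow>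
        bdd_above (sum (\<lambda>\<alpha>. norm (t \<alpha> * chi x \<alpha>)) ` {F. F \<subseteq> UNIV \<and> finite F})"
      by (subst summable_on_iff_abs_summable_on_real) (rule abs_summable_iff_bdd_above)
    also have "\<dots> \<longleftrightarrow> (\<exists>C. \<forall>F\<in>Collect finite. (\<Sum>\<alpha>\<in>F. \<bar>t \<alpha> * chi x \<alpha>\<bar>) \<le> C)"
      by (auto simp: bdd_above_def)
    also have "\<dots> \<longleftrightarrow> (\<exists>C::nat. \<forall>F\<in>Collect finite. (\<Sum>\<alpha>\<in>F. \<bar>t \<alpha> * chi x \<alpha>\<bar>) \<le> real C)"
      (is "(\<exists>C. \<forall>F\<in>_. ?s F \<le> C) \<longleftrightarrow> _")
    proof
      assume "\<exists>C. \<forall>F\<in>Collect finite. ?s F \<le> C"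
      then obtain C where C: "\<forall>F\<in>Collect finite. ?s F \<le> C" by blast
      obtain n where "C \<le> real n" using real_arch_simple by blast
      with C have "\<forall>F\<in>Collect finite. ?s F \<le> real n" by fastforce
      then show "\<exists>C::nat. \<forall>F\<in>Collect finite. ?s F \<le> real C" by blast
    qed blast
    finally show ?thesis .
  qed
  show ?thesis
    unfolding eq using countable_Collect_finite by measurable
qed

section \<open>Dependence of the moments on the times and on the lattice point\<close>

locale deformed_moments =
  fixes M :: "(real ^ 'd::finite) measure" and N :: "real ^ 'd ^ 'd" and q :: "real ^ 'd"
  assumes N: "invertible N" and sets_M [measurable_cong]: "sets M = sets borel"
    and support: "AE x in M. \<forall>a. \<bar>N $ a \<bullet> x\<bar> < \<bar>q $ a\<bar>"
begin

lemma integrable_moment: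
  assumes "t \<in> admissible_times M N q"
  shows "integrable M (\<lambda>x. chi x \<alpha> * weight N q t m x * chi x \<alpha>')"
proof -
  have "integrable M (\<lambda>x. chi x (\<alpha> + \<alpha>') * weight N q t m x)"
    using assms by (simp add: admissible_times_def)
  then show ?thesis by (simp add: chi_add mult_ac)
qed

lemma AE_summable: "t \<in> admissible_times M N q \<Longrightarrow> AE x in M. (\<lambda>\<alpha>. t \<alpha> * chi x \<alpha>) summable_on UNIV"
  by (simp add: admissible_times_def)

text \<open>Partial derivatives in t_c run along a whole line of times, and the factorization must
  be available at each of its points. The update multiplies the weight by a factor that is bounded
  almost everywhere, so all moments survive.\<close>

lemma admissible_times_update:
  assumes t: "t \<in> admissible_times M N q"
  shows "t(axis c 1 := s) \<in> admissible_times M N q"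
  unfolding admissible_times_def
proof (intro CollectI conjI allI)
  show "AE x in M. (\<lambda>\<alpha>. (t(axis c 1 := s)) \<alpha> * chi x \<alpha>) summable_on UNIV"
    using AE_summable[OF t] by eventually_elim (rule summable_on_times_update)
next
  fix m \<alpha>
  note [measurable] = measurable_summable_times[OF sets_M]
  obtain B where B: "AE x in M. \<bar>x $ c\<bar> \<le> B" by (rule AE_bounded_coordinate[OF N support])
  have "integrable M (\<lambda>x. (chi x \<alpha> * weight N q t m x) *
      (if (\<lambda>\<alpha>. t \<alpha> * chi x \<alpha>) summable_on UNIV then exp ((s - t (axis c 1)) * x $ c) else 1))"
  proof (rule integrable_mult_bounded)
    show "integrable M (\<lambda>x. chi x \<alpha> * weight N q t m x)"
      using t by (simp add: admissible_times_def)
    show "AE x in M. \<bar>if (\<lambda>\<alpha>. t \<alpha> * chi x \<alpha>) summable_on UNIV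
        then exp ((s - t (axis c 1)) * x $ c) else 1\<bar> \<le> exp (\<bar>s - t (axis c 1)\<bar> * B)"
      using B
    proof eventually_elim
      case (elim x)
      have "(s - t (axis c 1)) * x $ c \<le> \<bar>s - t (axis c 1)\<bar> * \<bar>x $ c\<bar>"
        by (simp add: abs_mult[symmetric])
      also have "\<dots> \<le> \<bar>s - t (axis c 1)\<bar> * B" using elim by (intro mult_left_mono) auto
      \<comment> \<open>The nonnegative exponent makes the bound cover the value \<open>1\<close>
        taken where the series diverges.\<close>
      moreover have "0 \<le> \<bar>s - t (axis c 1)\<bar> * B" using elim by (intro mult_nonneg_nonneg) auto
      ultimately show ?case by simp
    qed
  qed measurable
  then show "integrable M (\<lambda>x. chi x \<alpha> * weight N q (t(axis c 1 := s)) m x)"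
    unfolding weight_times_update by (simp add: mult.assoc)
qed

lemma moment_matrix_hankel:
  "moment_matrix M N q t m (\<gamma> + axis b 1) \<delta> = moment_matrix M N q t m \<gamma> (\<delta> + axis b 1)"
  by (simp add: moment_matrix_def chi_add mult_ac)

text \<open>Almost everywhere the update multiplies the integrand by
  \<open>exp ((s - t (axis c 1)) * x $ c)\<close>. Its derivative brings down a factor x_c, which
  raises the column index by e_c.\<close>

lemma moment_matrix_derivative:
  assumes t: "t \<in> admissible_times M N q"
  shows "((\<lambda>s. moment_matrix M N q (t(axis c 1 := s)) m \<alpha> \<alpha>') has_real_derivative
    moment_matrix M N q t m \<alpha> (\<alpha>' + axis c 1)) (at (t (axis c 1)))"
proof -
  obtain B where B: "AE x in M. \<bar>x $ c\<bar> \<le> B" by (rule AE_bounded_coordinate[OF N support])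
  let ?f = "\<lambda>x. chi x \<alpha> * weight N q t m x * chi x \<alpha>'"
  have "moment_matrix M N q (t(axis c 1 := s)) m \<alpha> \<alpha>'
      = (LINT x|M. ?f x * exp ((s - t (axis c 1)) * x $ c))" for s
    unfolding moment_matrix_def
  proof (rule integral_cong_AE)
    show "(\<lambda>x. chi x \<alpha> * weight N q (t(axis c 1 := s)) m x * chi x \<alpha>') \<in> borel_measurable M"
      using integrable_moment[OF admissible_times_update[OF t]] by (rule borel_measurable_integrable)
    have [measurable]: "?f \<in> borel_measurable M"
      using integrable_moment[OF t] by (rule borel_measurable_integrable)
    show "(\<lambda>x. ?f x * exp ((s - t (axis c 1)) * x $ c)) \<in> borel_measurable M"
      by measurable
    show "AE x in M. chi x \<alpha> * weight N q (t(axis c 1 := s)) m x * chi x \<alpha>'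
        = ?f x * exp ((s - t (axis c 1)) * x $ c)"
      using AE_summable[OF t] unfolding weight_times_update by eventually_elim simp
  qed
  moreover have "moment_matrix M N q t m \<alpha> (\<alpha>' + axis c 1) = (LINT x|M. ?f x * x $ c)"
    by (simp add: moment_matrix_def chi_add chi_axis[simplified] mult_ac)
  ultimately show ?thesis
    using has_real_derivative_integral_exp[OF integrable_moment[OF t] _ B] by simp
qed

text \<open>The nonvanishing factor matters for negative exponents: when \<open>m $ a\<close> is -1,
  a zero base would give \<open>0 powi 0 = 1\<close> on the left and 0 on the right.\<close>

lemma weight_shift:
  assumes "N $ a \<bullet> x \<noteq> q $ a"
  shows "weight N q t (m + axis a 1) x = (N $ a \<bullet> x - q $ a) * weight N q t m x"
proof -
  have "(\<Prod>i\<in>UNIV. (N $ i \<bullet> x - q $ i) powi ((m + axis a 1) $ i))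
      = (\<Prod>i\<in>UNIV. (N $ i \<bullet> x - q $ i) powi (m $ i) * (if a = i then N $ i \<bullet> x - q $ i else 1))"
    using assms by (intro prod.cong refl) (auto simp: axis_def power_int_add_1)
  then show ?thesis by (simp add: weight_def prod.distrib)
qed

text \<open>The strict support inequality excludes n_a \<cdot> x = q_a almost everywhere, so
  \<open>weight_shift\<close> can be integrated; expanding n_a \<cdot> x raises the column index by
  unit vectors.\<close>

lemma moment_matrix_shift:
  assumes t: "t \<in> admissible_times M N q"
  shows "moment_matrix M N q t (m + axis a 1) \<alpha> \<alpha>'
    = (\<Sum>b\<in>UNIV. N $ a $ b * moment_matrix M N q t m \<alpha> (\<alpha>' + axis b 1))
      - q $ a * moment_matrix M N q t m \<alpha> \<alpha>'"
proof -
  let ?f = "\<lambda>x \<alpha>'. chi x \<alpha> * weight N q t m x * chi x \<alpha>'"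
  let ?g = "\<lambda>x. (\<Sum>b\<in>UNIV. N $ a $ b * ?f x (\<alpha>' + axis b 1)) - q $ a * ?f x \<alpha>'"
  have g: "?g x = (N $ a \<bullet> x - q $ a) * ?f x \<alpha>'" for x
    by (simp add: chi_add chi_axis[simplified] inner_vec_def algebra_simps sum_distrib_left)
  have int: "integrable M (\<lambda>x. ?f x \<beta>)" for \<beta> by (rule integrable_moment[OF t])
  have "moment_matrix M N q t (m + axis a 1) \<alpha> \<alpha>' = (LINT x|M. ?g x)"
    unfolding moment_matrix_def
  proof (rule integral_cong_AE)
    show "(\<lambda>x. chi x \<alpha> * weight N q t (m + axis a 1) x * chi x \<alpha>') \<in> borel_measurable M"
      using integrable_moment[OF t] by (rule borel_measurable_integrable)
    show "?g \<in> borel_measurable M"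
      using int by (intro borel_measurable_integrable) simp
    show "AE x in M. chi x \<alpha> * weight N q t (m + axis a 1) x * chi x \<alpha>' = ?g x"
      using support
    proof eventually_elim
      case (elim x)
      then have "N $ a \<bullet> x \<noteq> q $ a" by (metis less_irrefl)
      then show ?case unfolding g by (simp add: weight_shift mult_ac)
    qed
  qed
  also have "\<dots> = (\<Sum>b\<in>UNIV. N $ a $ b * moment_matrix M N q t m \<alpha> (\<alpha>' + axis b 1))
      - q $ a * moment_matrix M N q t m \<alpha> \<alpha>'"
    unfolding moment_matrix_def using int by simp
  finally show ?thesis .
qed

end

subsection \<open>The lattice equations\<close>

definition second_subdiagonal :: "'d::finite smat \<Rightarrow> 'd smat" where
  "second_subdiagonal S = (\<lambda>\<alpha> \<alpha>'. if mdeg \<alpha> = mdeg \<alpha>' + 2 then S \<alpha> \<alpha>' else 0)"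

lemma smult_dotLam:
  assumes "mdeg \<epsilon> \<le> n"
  shows "(X \<odot> dotLam v) \<alpha> \<epsilon> = (\<Sum>\<zeta>\<in>below n. X \<alpha> \<zeta> * dotLam v \<zeta> \<epsilon>)"
  using assms by (intro smult_eq_sum) (auto dest: dotLam_nonzero_mdeg)

lemma smult_dotLam_diff: "X \<odot> dotLam v - Y \<odot> dotLam v = (X - Y) \<odot> dotLam v"
  by (intro ext) (simp add: smult_dotLam[OF order_refl] left_diff_distrib sum_subtractf)

lemma dotLam_mult_dotLam:
  assumes "mdeg \<gamma> < k"
  shows "(\<Sum>\<zeta>\<in>below (Suc k). dotLam u \<gamma> \<zeta> * dotLam v \<zeta> \<epsilon>)
    = (\<Sum>c\<in>UNIV. \<Sum>e\<in>UNIV. u $ c * (v $ e * (if \<gamma> + axis c 1 + axis e 1 = \<epsilon> then 1 else 0)))"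
  unfolding sum_dotLam[OF assms] by (simp add: dotLam_def Lam_def sum_distrib_left)

lemma dotLam_commute:
  assumes "mdeg \<gamma> < k"
  shows "(\<Sum>\<zeta>\<in>below (Suc k). dotLam u \<gamma> \<zeta> * dotLam v \<zeta> \<epsilon>)
    = (\<Sum>\<zeta>\<in>below (Suc k). dotLam v \<gamma> \<zeta> * dotLam u \<zeta> \<epsilon>)"
  unfolding dotLam_mult_dotLam[OF assms]
  by (subst sum.swap) (simp only: mult.left_commute add_ac)

text \<open>The columns of n \<cdot> \<Lambda> have finite support, so for arbitrary
  \<open>X\<close> both products are finite sums and can be reassociated. The claim then rests on
  e_c + e_e = e_e + e_c.\<close>

lemma smult_dotLam_commute:
  "X \<odot> dotLam u \<odot> dotLam v = X \<odot> dotLam v \<odot> dotLam u"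
proof -
  have *: "(X \<odot> dotLam u \<odot> dotLam v) \<alpha> \<epsilon>
      = (\<Sum>\<gamma>\<in>below (mdeg \<epsilon>). X \<alpha> \<gamma> * (\<Sum>\<zeta>\<in>below (Suc (mdeg \<epsilon>)). dotLam u \<gamma> \<zeta> * dotLam v \<zeta> \<epsilon>))"
    for u v \<alpha> \<epsilon>
  proof -
    have "(X \<odot> dotLam u \<odot> dotLam v) \<alpha> \<epsilon>
        = (\<Sum>\<zeta>\<in>below (Suc (mdeg \<epsilon>)). (X \<odot> dotLam u) \<alpha> \<zeta> * dotLam v \<zeta> \<epsilon>)"
      by (rule smult_dotLam) simp
    also have "\<dots> = (\<Sum>\<zeta>\<in>below (Suc (mdeg \<epsilon>)).
        (\<Sum>\<gamma>\<in>below (mdeg \<epsilon>). X \<alpha> \<gamma> * dotLam u \<gamma> \<zeta>) * dotLam v \<zeta> \<epsilon>)"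
      by (intro sum.cong refl arg_cong2[of _ _ _ _ "(*)"] smult_dotLam) auto
    finally show ?thesis by (simp only: sum_mult_assoc)
  qed
  show ?thesis
    by (intro ext, unfold *, intro sum.cong refl arg_cong2[of _ _ _ _ "(*)"] dotLam_commute) simp
qed

section \<open>Time derivatives of \<open>S\<close> and the equation for its first
  subdiagonal\<close>

locale deformed_factorizations = deformed_moments M N q
  for M :: "(real ^ 'd::finite) measure" and N :: "real ^ 'd ^ 'd" and q :: "real ^ 'd" +
  fixes S H :: "'d times \<Rightarrow> int ^ 'd \<Rightarrow> 'd smat"
  assumes chol: "t \<in> admissible_times M N q \<Longrightarrow>
    block_cholesky (moment_matrix M N q t m) (S t m) (H t m)"
begin

text \<open>Entries on or above the block diagonal are constant. Those below it in row \<alpha>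
  solve the linear system of orthogonality relations, whose right side comes from the diagonal entry
  1 and whose matrix is the invertible truncation of the moment matrix.\<close>

lemma differentiable_S:
  assumes t: "t \<in> admissible_times M N q"
  shows "(\<lambda>s. S (t(axis c 1 := s)) m \<alpha> \<gamma>) differentiable (at (t (axis c 1)))"
proof (cases "mdeg \<alpha> \<le> mdeg \<gamma>")
  case True
  then show ?thesis
    by (simp only: block_cholesky_lower[OF chol[OF admissible_times_update[OF t]]] differentiable_const)
next
  case False
  let ?t = "\<lambda>s. t(axis c 1 := s)" and ?s0 = "t (axis c 1)"
  let ?G = "\<lambda>s. moment_matrix M N q (?t s) m" and ?I = "below (mdeg \<alpha>) :: 'd mindex set"
  note chol_s = chol[OF admissible_times_update[OF t]]
  obtain K where K: "\<And>\<alpha>' \<alpha>''. mdeg \<alpha>' < mdeg \<alpha> \<Longrightarrow> mdeg \<alpha>'' < mdeg \<alpha> \<Longrightarrow>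
      (\<Sum>\<gamma>\<in>?I. ?G ?s0 \<alpha>' \<gamma> * K \<gamma> \<alpha>'') = (if \<alpha>' = \<alpha>'' then 1 else 0)"
    by (fact block_cholesky_right_inverse[OF chol_s])
  have G: "(\<lambda>s. ?G s \<gamma> \<delta>) differentiable (at ?s0)" for \<gamma> \<delta>
    using moment_matrix_derivative[OF t] unfolding real_differentiable_def by blast
  have sys: "(\<Sum>\<gamma>\<in>?I. S (?t s) m \<alpha> \<gamma> * ?G s \<gamma> \<delta>) = - ?G s \<alpha> \<delta>" if "\<delta> \<in> ?I" for s \<delta>
  proof -
    have "(\<Sum>\<gamma>\<in>?I \<union> level (mdeg \<alpha>). S (?t s) m \<alpha> \<gamma> * ?G s \<gamma> \<delta>)
        = (\<Sum>\<gamma>\<in>below (Suc (mdeg \<alpha>)). S (?t s) m \<alpha> \<gamma> * ?G s \<gamma> \<delta>)"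
      by (intro sum.cong) auto
    also have "\<dots> = 0" using that by (intro block_cholesky_orthogonal[OF chol_s]) auto
    finally have "(\<Sum>\<gamma>\<in>?I. S (?t s) m \<alpha> \<gamma> * ?G s \<gamma> \<delta>)
        = - (\<Sum>\<gamma>\<in>level (mdeg \<alpha>). S (?t s) m \<alpha> \<gamma> * ?G s \<gamma> \<delta>)"
      by (subst (asm) sum.union_disjoint) auto
    also have "(\<Sum>\<gamma>\<in>level (mdeg \<alpha>). S (?t s) m \<alpha> \<gamma> * ?G s \<gamma> \<delta>)
        = (\<Sum>\<gamma>\<in>level (mdeg \<alpha>). if \<alpha> = \<gamma> then ?G s \<gamma> \<delta> else 0)"
      by (intro sum.cong) (auto simp: block_cholesky_lower[OF chol_s] simp del: One_nat_def)
    also have "\<dots> = ?G s \<alpha> \<delta>" by simp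
    finally show ?thesis .
  qed
  show ?thesis
    using False K by (intro linear_system_differentiable[where K = K, OF finite_below sys _ G] differentiable_minus G) auto
qed

definition dS :: "'d \<Rightarrow> 'd times \<Rightarrow> int ^ 'd \<Rightarrow> 'd smat" where
  "dS c t m \<alpha> \<gamma> = deriv (\<lambda>s. S (t(axis c 1 := s)) m \<alpha> \<gamma>) (t (axis c 1))"

lemma has_derivative_S:
  assumes "t \<in> admissible_times M N q"
  shows "((\<lambda>s. S (t(axis c 1 := s)) m \<alpha> \<gamma>) has_real_derivative dS c t m \<alpha> \<gamma>) (at (t (axis c 1)))"
  unfolding dS_def DERIV_deriv_iff_real_differentiable by (rule differentiable_S[OF assms])

text \<open>The product rule is applied to the orthogonality relation, which holds identically along
  the line of updated times. Entries of \<open>S\<close> in columns of degree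
  \<open>mdeg \<alpha>\<close> are constant, so the sum with \<open>dS\<close> stops one degree
  earlier. This is the hypothesis on \<open>D\<close> in \<open>toda_row\<close>, one coordinate
  direction at a time.\<close>

lemma sum_dS_moment:
  assumes t: "t \<in> admissible_times M N q" and \<delta>: "mdeg \<delta> < mdeg \<alpha>"
  shows "(\<Sum>\<gamma>\<in>below (mdeg \<alpha>). dS c t m \<alpha> \<gamma> * moment_matrix M N q t m \<gamma> \<delta>)
    = - (\<Sum>\<gamma>\<in>below (Suc (mdeg \<alpha>)). S t m \<alpha> \<gamma> * moment_matrix M N q t m \<gamma> (\<delta> + axis c 1))"
proof -
  let ?t = "\<lambda>s. t(axis c 1 := s)" and ?s0 = "t (axis c 1)"
  let ?G = "moment_matrix M N q" and ?U = "below (Suc (mdeg \<alpha>)) :: 'd mindex set"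
  note chol_s = chol[OF admissible_times_update[OF t]]
  have "((\<lambda>s. \<Sum>\<gamma>\<in>?U. S (?t s) m \<alpha> \<gamma> * ?G (?t s) m \<gamma> \<delta>) has_real_derivative
      (\<Sum>\<gamma>\<in>?U. dS c t m \<alpha> \<gamma> * ?G (?t ?s0) m \<gamma> \<delta> + ?G t m \<gamma> (\<delta> + axis c 1) * S (?t ?s0) m \<alpha> \<gamma>)) (at ?s0)"
    by (intro DERIV_sum DERIV_mult has_derivative_S moment_matrix_derivative t)
  moreover have "(\<Sum>\<gamma>\<in>?U. S (?t s) m \<alpha> \<gamma> * ?G (?t s) m \<gamma> \<delta>) = 0" for s
    using \<delta> by (intro block_cholesky_orthogonal[OF chol_s]) auto
  ultimately have "((\<lambda>s. 0) has_real_derivative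
      (\<Sum>\<gamma>\<in>?U. dS c t m \<alpha> \<gamma> * ?G t m \<gamma> \<delta> + ?G t m \<gamma> (\<delta> + axis c 1) * S t m \<alpha> \<gamma>)) (at ?s0)"
    by (simp only: fun_upd_triv)
  then have "(\<Sum>\<gamma>\<in>?U. dS c t m \<alpha> \<gamma> * ?G t m \<gamma> \<delta> + ?G t m \<gamma> (\<delta> + axis c 1) * S t m \<alpha> \<gamma>) = 0"
    by (rule DERIV_unique) (rule DERIV_const)
  moreover have "(\<Sum>\<gamma>\<in>?U. dS c t m \<alpha> \<gamma> * ?G t m \<gamma> \<delta>) = (\<Sum>\<gamma>\<in>below (mdeg \<alpha>). dS c t m \<alpha> \<gamma> * ?G t m \<gamma> \<delta>)"
  proof (rule sum_below_Suc)
    fix \<gamma> :: "'d mindex" assume "mdeg \<gamma> = mdeg \<alpha>"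
    then have "dS c t m \<alpha> \<gamma> = 0"
      unfolding dS_def by (simp only: block_cholesky_lower[OF chol_s] deriv_const)
    then show "dS c t m \<alpha> \<gamma> * ?G t m \<gamma> \<delta> = 0" by simp
  qed
  ultimately show ?thesis by (simp add: sum.distrib mult.commute)
qed

lemma contiguous:
  assumes t: "t \<in> admissible_times M N q"
  shows "contiguous_factorizations (moment_matrix M N q t m) (S t m) (H t m)
    (moment_matrix M N q t (m + axis a 1)) (S t (m + axis a 1)) (H t (m + axis a 1)) (N $ a) (q $ a)"
  using chol[OF t] moment_matrix_shift[OF t] moment_matrix_hankel by unfold_locales auto

lemma normal_deriv_subdiagonal:
  "normal_deriv n (\<lambda>t m. subdiagonal (S t m)) t m \<alpha> \<epsilon>
    = (if mdeg \<alpha> = mdeg \<epsilon> + 1 then \<Sum>b\<in>UNIV. n $ b * dS b t m \<alpha> \<epsilon> else 0)"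
  by (simp add: normal_deriv_def subdiagonal_def dS_def)

text \<open>Both sides live on the first block subdiagonal: \<beta> lowers the degree by one,
  \<open>?X\<close> preserves it, and the second subdiagonal lowers it by two before n_a \<cdot>
  \<Lambda> raises it by one. There the entries agree by \<open>toda_row\<close>.\<close>

lemma toda_equation:
  assumes t: "t \<in> admissible_times M N q"
  defines "\<beta> \<equiv> \<lambda>t m. subdiagonal (S t m)"
  shows "normal_deriv (N $ a) \<beta> t m
      + lattice_diff a \<beta> t m \<odot> (scalar (q $ a) + dotLam (N $ a) \<odot> \<beta> t m)
    = lattice_diff a (\<lambda>t m. second_subdiagonal (S t m)) t m \<odot> dotLam (N $ a)"
    (is "_ + ?\<Delta> \<odot> ?X = ?\<Delta>2 \<odot> _")
proof (intro ext)
  fix \<alpha> \<epsilon> :: "'d mindex"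
  let ?D = "\<lambda>\<gamma>. S t (m + axis a 1) \<alpha> \<gamma> - S t m \<alpha> \<gamma>"
  \<comment> \<open>\<open>?X\<close> is block diagonal, because the degree shifts of n_a \<cdot>
    \<Lambda> and \<beta> cancel.\<close>
  have X: "?X \<gamma> \<epsilon> = (if mdeg \<gamma> = mdeg \<epsilon> then (if \<gamma> = \<epsilon> then q $ a else 0)
      + (\<Sum>\<zeta>\<in>level (Suc (mdeg \<gamma>)). dotLam (N $ a) \<gamma> \<zeta> * S t m \<zeta> \<epsilon>) else 0)" for \<gamma>
  proof -
    have "(dotLam (N $ a) \<odot> \<beta> t m) \<gamma> \<epsilon>
        = (\<Sum>\<zeta>\<in>level (Suc (mdeg \<gamma>)). dotLam (N $ a) \<gamma> \<zeta> * \<beta> t m \<zeta> \<epsilon>)"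
      by (intro smult_eq_sum) (auto dest: dotLam_nonzero_mdeg)
    also have "\<dots> = (if mdeg \<gamma> = mdeg \<epsilon>
        then \<Sum>\<zeta>\<in>level (Suc (mdeg \<gamma>)). dotLam (N $ a) \<gamma> \<zeta> * S t m \<zeta> \<epsilon> else 0)"
      by (auto simp: \<beta>_def subdiagonal_def intro!: sum.cong sum.neutral)
    finally show ?thesis by (auto simp: scalar_def)
  qed
  have \<Delta>: "?\<Delta> \<alpha> \<gamma> = (if mdeg \<alpha> = mdeg \<gamma> + 1 then ?D \<gamma> else 0)" for \<gamma>
    by (simp add: lattice_diff_def \<beta>_def subdiagonal_def)
  have \<Delta>2: "?\<Delta>2 \<alpha> \<gamma> = (if mdeg \<alpha> = mdeg \<gamma> + 2 then ?D \<gamma> else 0)" for \<gamma>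
    by (simp add: lattice_diff_def second_subdiagonal_def)
  have \<Delta>X: "(?\<Delta> \<odot> ?X) \<alpha> \<epsilon> = (\<Sum>\<gamma>\<in>level (mdeg \<epsilon>). ?\<Delta> \<alpha> \<gamma> * ?X \<gamma> \<epsilon>)"
    by (intro smult_eq_sum) (auto simp: X[unfolded plus_fun_apply])
  have \<Delta>2L: "(?\<Delta>2 \<odot> dotLam (N $ a)) \<alpha> \<epsilon>
      = (\<Sum>\<zeta>\<in>below (Suc (mdeg \<epsilon>)). ?\<Delta>2 \<alpha> \<zeta> * dotLam (N $ a) \<zeta> \<epsilon>)"
    by (rule smult_dotLam) simp
  show "(normal_deriv (N $ a) \<beta> t m + ?\<Delta> \<odot> ?X) \<alpha> \<epsilon> = (?\<Delta>2 \<odot> dotLam (N $ a)) \<alpha> \<epsilon>"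
  proof (cases "mdeg \<alpha> = Suc (mdeg \<epsilon>)")
    case False
    have "(?\<Delta> \<odot> ?X) \<alpha> \<epsilon> = 0"
      unfolding \<Delta>X using False by (intro sum.neutral) (auto simp: \<Delta>)
    moreover have "(?\<Delta>2 \<odot> dotLam (N $ a)) \<alpha> \<epsilon> = 0"
      unfolding \<Delta>2L using False by (intro sum.neutral) (auto simp: \<Delta>2 dest: dotLam_nonzero_mdeg)
    ultimately show ?thesis
      using False by (simp add: \<beta>_def normal_deriv_subdiagonal)
  next
    case True
    interpret contiguous_factorizations "moment_matrix M N q t m" "S t m" "H t m"
      "moment_matrix M N q t (m + axis a 1)" "S t (m + axis a 1)" "H t (m + axis a 1)" "N $ a" "q $ a"
      by (rule contiguous[OF t])
    let ?d = "\<lambda>\<gamma>. \<Sum>b\<in>UNIV. N $ a $ b * dS b t m \<alpha> \<gamma>"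
    have "(?\<Delta> \<odot> ?X) \<alpha> \<epsilon> = (\<Sum>\<gamma>\<in>level (mdeg \<epsilon>). ?D \<gamma> * ((if \<gamma> = \<epsilon> then q $ a else 0)
        + (\<Sum>\<zeta>\<in>level (Suc (mdeg \<epsilon>)). dotLam (N $ a) \<gamma> \<zeta> * S t m \<zeta> \<epsilon>)))"
      unfolding \<Delta>X using True by (intro sum.cong) (auto simp: \<Delta> X[unfolded plus_fun_apply])
    also have "\<dots> = (\<Sum>\<gamma>\<in>level (mdeg \<epsilon>). if \<gamma> = \<epsilon> then ?D \<gamma> * q $ a else 0)
        + (\<Sum>\<gamma>\<in>level (mdeg \<epsilon>). ?D \<gamma> * (\<Sum>\<zeta>\<in>level (Suc (mdeg \<epsilon>)). dotLam (N $ a) \<gamma> \<zeta> * S t m \<zeta> \<epsilon>))"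
      unfolding sum.distrib[symmetric] by (intro sum.cong) (auto simp: distrib_left)
    also have "(\<Sum>\<gamma>\<in>level (mdeg \<epsilon>). if \<gamma> = \<epsilon> then ?D \<gamma> * q $ a else 0) = ?D \<epsilon> * q $ a"
      by simp
    finally have \<Delta>X': "(?\<Delta> \<odot> ?X) \<alpha> \<epsilon> = ?D \<epsilon> * q $ a
        + (\<Sum>\<gamma>\<in>level (mdeg \<epsilon>). ?D \<gamma> * (\<Sum>\<zeta>\<in>level (Suc (mdeg \<epsilon>)). dotLam (N $ a) \<gamma> \<zeta> * S t m \<zeta> \<epsilon>))" .
    have "normal_deriv (N $ a) \<beta> t m \<alpha> \<epsilon> = ?d \<epsilon>"
      using True by (simp add: \<beta>_def normal_deriv_subdiagonal)
    then have "(normal_deriv (N $ a) \<beta> t m + ?\<Delta> \<odot> ?X) \<alpha> \<epsilon> = ?d \<epsilon> + ?D \<epsilon> * q $ a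
        + (\<Sum>\<gamma>\<in>level (mdeg \<epsilon>). ?D \<gamma> * (\<Sum>\<zeta>\<in>level (Suc (mdeg \<epsilon>)). dotLam (N $ a) \<gamma> \<zeta> * S t m \<zeta> \<epsilon>))"
      by (simp only: plus_fun_apply[of "normal_deriv (N $ a) \<beta> t m"]
        plus_fun_apply[of "normal_deriv (N $ a) \<beta> t m \<alpha>"] \<Delta>X' add.assoc)
    also have "\<dots> = (\<Sum>\<zeta>\<in>below (Suc (mdeg \<epsilon>)). ?D \<zeta> * dotLam (N $ a) \<zeta> \<epsilon>)"
    proof (rule toda_row[OF True refl])
      fix \<delta> :: "'d mindex" assume \<delta>: "mdeg \<delta> < Suc (mdeg \<epsilon>)"
      let ?G = "moment_matrix M N q t m"
      have \<delta>': "mdeg \<delta> < mdeg \<alpha>" using \<delta> True by simp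
      have "(\<Sum>\<gamma>\<in>below (Suc (mdeg \<epsilon>)). ?d \<gamma> * ?G \<gamma> \<delta>)
          = (\<Sum>b\<in>UNIV. N $ a $ b * (\<Sum>\<gamma>\<in>below (mdeg \<alpha>). dS b t m \<alpha> \<gamma> * ?G \<gamma> \<delta>))"
        unfolding True by (rule sum_mult_assoc)
      also have "\<dots> = - (\<Sum>b\<in>UNIV. N $ a $ b *
          (\<Sum>\<gamma>\<in>below (Suc (mdeg \<alpha>)). S t m \<alpha> \<gamma> * ?G \<gamma> (\<delta> + axis b 1)))"
        by (simp only: sum_dS_moment[OF t \<delta>'] mult_minus_right sum_negf)
      finally show "(\<Sum>\<gamma>\<in>below (Suc (mdeg \<epsilon>)). ?d \<gamma> * ?G \<gamma> \<delta>) = - (\<Sum>b\<in>UNIV. N $ a $ b *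
          (\<Sum>\<gamma>\<in>below (Suc (Suc (mdeg \<epsilon>))). S t m \<alpha> \<gamma> * ?G \<gamma> (\<delta> + axis b 1)))"
        unfolding True .
    qed
    also have "\<dots> = (?\<Delta>2 \<odot> dotLam (N $ a)) \<alpha> \<epsilon>"
      unfolding \<Delta>2L using True by (intro sum.cong) (auto simp: \<Delta>2 dest: dotLam_nonzero_mdeg)
    finally show ?thesis .
  qed
qed

end

theorem theorem5p2p1:
  fixes M :: "(real ^ 'd::finite) measure"
    and N :: "real ^ 'd ^ 'd"
    and q :: "real ^ 'd"
    and S H \<beta> :: "'d times \<Rightarrow> int ^ 'd \<Rightarrow> 'd smat"
  assumes "invertible N"
    and "\<And>a. q $ a \<noteq> 0"
    and "sets M = sets borel"
    and "\<And>\<alpha>. integrable M (\<lambda>x. chi x \<alpha>)"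
    and "AE x in M. \<forall>a. \<bar>N $ a \<bullet> x\<bar> < \<bar>q $ a\<bar>"
    and "\<And>t m. t \<in> admissible_times M N q \<Longrightarrow>
           block_cholesky (moment_matrix M N q t m) (S t m) (H t m)"
    and "\<And>t m. \<beta> t m = subdiagonal (S t m)"
  shows "\<forall>t \<in> admissible_times M N q. \<forall>m.
      (\<forall>c \<alpha> \<alpha>'. (\<lambda>s. \<beta> (t(axis c 1 := s)) m \<alpha> \<alpha>') differentiable at (t (axis c 1))) \<and>
      (\<forall>a b.
        lattice_diff b (\<lambda>t m. normal_deriv (N $ a) \<beta> t m
            + lattice_diff a \<beta> t m \<odot> (scalar (q $ a) + dotLam (N $ a) \<odot> \<beta> t m)) t m
          \<odot> dotLam (N $ b)
        = lattice_diff a (\<lambda>t m. normal_deriv (N $ b) \<beta> t m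
            + lattice_diff b \<beta> t m \<odot> (scalar (q $ b) + dotLam (N $ b) \<odot> \<beta> t m)) t m
          \<odot> dotLam (N $ a))"
proof (intro ballI allI conjI)
  fix t m assume t: "t \<in> admissible_times M N q"
  interpret deformed_factorizations M N q S H
    using assms by unfold_locales auto
  have \<beta>: "\<beta> = (\<lambda>t m. subdiagonal (S t m))"
    using assms(7) by (intro ext) simp
  \<comment> \<open>\<open>deriv\<close> yields some value even where no derivative exists; this
    part ensures that \<open>normal_deriv\<close> is the genuine derivative of \<beta>.\<close>
  show "(\<lambda>s. \<beta> (t(axis c 1 := s)) m \<alpha> \<alpha>') differentiable at (t (axis c 1))" for c \<alpha> \<alpha>'
    unfolding \<beta> subdiagonal_def
    by (cases "mdeg \<alpha> = mdeg \<alpha>' + 1") (simp_all del: One_nat_def add: differentiable_S[OF t])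
  define S2 where "S2 = (\<lambda>t m. second_subdiagonal (S t m))"
  \<comment> \<open>\<open>toda_equation\<close> is used at \<open>m\<close> and at
    \<open>m + axis b 1\<close> with the same \<open>t\<close>; the outer difference then moves
    inside the product, whose right factor does not depend on \<open>m\<close>.\<close>
  have E: "lattice_diff b (\<lambda>t m. normal_deriv (N $ a) \<beta> t m
        + lattice_diff a \<beta> t m \<odot> (scalar (q $ a) + dotLam (N $ a) \<odot> \<beta> t m)) t m
      = lattice_diff b (lattice_diff a S2) t m \<odot> dotLam (N $ a)" for a b
    unfolding lattice_diff_def[of b] smult_dotLam_diff[symmetric] S2_def \<beta>
    by (simp only: toda_equation[OF t])
  have comm: "lattice_diff b (lattice_diff a S2) t m = lattice_diff a (lattice_diff b S2) t m" for a b
    by (simp add: lattice_diff_def algebra_simps)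
  show "lattice_diff b (\<lambda>t m. normal_deriv (N $ a) \<beta> t m
            + lattice_diff a \<beta> t m \<odot> (scalar (q $ a) + dotLam (N $ a) \<odot> \<beta> t m)) t m
          \<odot> dotLam (N $ b)
        = lattice_diff a (\<lambda>t m. normal_deriv (N $ b) \<beta> t m
            + lattice_diff b \<beta> t m \<odot> (scalar (q $ b) + dotLam (N $ b) \<odot> \<beta> t m)) t m
          \<odot> dotLam (N $ a)" for a b
    unfolding E comm[of b a] by (rule smult_dotLam_commute)
qed

end
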